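(* Let $m\ge 1$ and $n\ge 0$ be integers, and let $w_{m,n}=[m+n,\,m-1,m-2,\ldots,1,\,m,m+1,\ldots,m+n-1]\in\mathfrak{S}_{m+n}$. The map $\psi:\mathcal{R}(w_{m,n})\to\mathcal{SMR}(L_{m,n})$ is a bijection, and $\mathrm{Des}(\sigma)=\mathrm{Des}(\psi(\sigma))$ for all $\sigma\in\mathcal{R}(w_{m,n})$.
   Context: **Permutations.** $s_i$ is the adjacent transposition; $w\circ s_i$ swaps the entries of $w$ in positions $i,i+1$. $\mathcal{R}(w)$ is the set of reduced words of $w$, i.e. minimal-length sequences $i_1\cdots i_\ell$ with $w=s_{i_1}\circ\cdots\circ s_{i_\ell}$. The (right) weak order on $\mathfrak{S}_N$ has covers $u\lessdot u\circ s_i$ when $u(i)<u(i+1)$. **Tubing lattice.** $L_{m,n}$ is the graph on $[m+n]$ which is the complete graph on $\{1,\ldots,m\}$ together with the path $m,m+1,\ldots,m+n$. For a connected graph $G$ on $N$ integer vertices and an ordering $w=[w(1),\ldots,w(N)]$ of its vertices, the $G$-tree of $w$ is the rooted tree defined inductively: the root is $w(N)$; if $G_1,\ldots,G_k$ are the connected components of $G$ with $w(N)$ deleted and $w_i$ is the subword of $w$ on the vertices of $G_i$, the children of $w(N)$ are the roots of the $G_i$-trees of the $w_i$ (with those trees attached below). Two permutations are $G$-equivalent if they have the same $G$-tree; $[\![u]\!]$ is the class of $u$. For $G=L_{m,n}$ each class has a unique minimal and a unique maximal element in weak order, and $\mathfrak{L}(G)$ is the poset (lattice) of classes with $[\![u]\!]\le[\![v]\!]$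 iff the minimal element of $[\![u]\!]$ is $\le$ the minimal element of $[\![v]\!]$ in weak order. **Cycle sequences.** An adjacent cycle is $c=(a,b,b-1,\ldots,a+1)$ with $a<b$, the permutation with $c(a)=b$, $c(i)=i-1$ for $a<i\le b$, and $c(i)=i$ otherwise. For a maximal chain $[\![u_0]\!]\lessdot[\![u_1]\!]\lessdot\cdots\lessdot[\![u_\ell]\!]$ in $\mathfrak{L}(L_{m,n})$ with each $u_k$ the maximal element of its class, there are adjacent cycles $c_k$ with $u_{k-1}\circ c_k=u_k$; the associated sequence is $\gamma=c_1c_2\cdots c_\ell$, of length $|\gamma|=\ell$. $\mathcal{SMR}(L_{m,n})$ is the set of such sequences arising from maximal chains of $\mathfrak{L}(L_{m,n})$ of the shortest possible length. **Descents.** For a word $\sigma$, $\mathrm{Des}(\sigma)=\{i:\sigma_i>\sigma_{i+1}\}$. For $\gamma=c_1\cdots c_\ell$ with $c_i=(a_i,b_i,b_i-1,\ldots,a_i+1)$, $\mathrm{Des}(\gamma)=\{i:b_i\ge b_{i+1}\}$. **The map $\psi$.** For $\sigma\in\mathcal{R}(w_{m,n})$, each of the letters $m+n-1,m+n-2,\ldots,m$ appears exactly once, in this order; let $I_1$ be the set of indices at which they appear (the letters at the other indices form a reduced word of the longest permutation of $\mathfrak{S}_m$). Then $\psi(\sigma)=\gamma_1\gamma_2\cdots$, where: for $i\in I_1$, $\gamma_i=(m+n-\sigma_i,\;m+n,\;m+n-1,\ldots,m+n-\sigma_i+1)$; for $i\notin I_1$, $\gamma_i=(\sigma_i+l,\sigma_i+l+1)$,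 where $l$ is the number of elements of $I_1$ less than $i$. *)

theory Defs
  imports Main "HOL-Combinatorics.Permutations" "HOL-Library.FSet"
begin

text \<open>Elements of \<open>S\<^sub>N\<close> are functions \<open>w :: nat \<Rightarrow> nat\<close> with \<open>w permutes {1..N}\<close>.
  Positions in words and sequences are counted from \<open>1\<close>, so the \<open>i\<close>-th entry of a list \<open>xs\<close> is
  \<open>xs ! (i - 1)\<close>.\<close>

definition of_one_line :: "nat list \<Rightarrow> nat \<Rightarrow> nat" where
  "of_one_line xs i = (if 1 \<le> i \<and> i \<le> length xs then xs ! (i - 1) else i)"

definition one_line :: "nat \<Rightarrow> (nat \<Rightarrow> nat) \<Rightarrow> nat list" where
  "one_line N w = map w [1..<Suc N]"

definition adj_transp :: "nat \<Rightarrow> nat \<Rightarrow> nat" where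
  "adj_transp i = transpose i (i + 1)"

definition word_perm :: "nat list \<Rightarrow> nat \<Rightarrow> nat" where
  "word_perm \<sigma> = foldr (\<lambda>i f. adj_transp i \<circ> f) \<sigma> id"

definition reduced_words :: "nat \<Rightarrow> (nat \<Rightarrow> nat) \<Rightarrow> nat list set" where
  "reduced_words N w =
     {\<sigma>. set \<sigma> \<subseteq> {1..<N} \<and> word_perm \<sigma> = w \<and>
         (\<forall>\<tau>. set \<tau> \<subseteq> {1..<N} \<and> word_perm \<tau> = w \<longrightarrow> length \<sigma> \<le> length \<tau>)}"

definition weak_cover :: "nat \<Rightarrow> (nat \<Rightarrow> nat) \<Rightarrow> (nat \<Rightarrow> nat) \<Rightarrow> bool" where
  "weak_cover N u v \<longleftrightarrow>
     u permutes {1..N} \<and> (\<exists>i\<in>{1..<N}. u i < u (i + 1) \<and> v = u \<circ> adj_transp i)"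

definition weak_le :: "nat \<Rightarrow> (nat \<Rightarrow> nat) \<Rightarrow> (nat \<Rightarrow> nat) \<Rightarrow> bool" where
  "weak_le N = (weak_cover N)\<^sup>*\<^sup>*"

text \<open>A graph is given by its (symmetric) adjacency relation; its vertex set is the set of
  entries of the word under consideration.\<close>

definition lollipop :: "nat \<Rightarrow> nat \<Rightarrow> (nat \<times> nat) set" where
  "lollipop m n =
     {(i, j). i \<in> {1..m} \<and> j \<in> {1..m} \<and> i \<noteq> j} \<union>
     {(i, j). i \<in> {m..m + n} \<and> j \<in> {m..m + n} \<and> (j = i + 1 \<or> i = j + 1)}"

definition component :: "(nat \<times> nat) set \<Rightarrow> nat set \<Rightarrow> nat \<Rightarrow> nat set" where
  "component E S v = {u \<in> S. (v, u) \<in> (E \<inter> S \<times> S)\<^sup>*}"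

text \<open>The children of a node form a set, since the branches of a \<open>G\<close>-tree are unordered.\<close>

datatype rtree = Node nat "rtree fset"

text \<open>Below, the children are indexed by the remaining vertices \<open>v\<close>: vertices in the same
  component give the same subword, hence the same child. The value on the empty word is
  irrelevant.\<close>

function gtree :: "(nat \<times> nat) set \<Rightarrow> nat list \<Rightarrow> rtree" where
  "gtree E [] = undefined"
| "gtree E (ws @ [r]) =
     Node r ((\<lambda>v. gtree E (filter (\<lambda>u. u \<in> component E (set ws) v) ws)) |`| fset_of_list ws)"
  by auto (meson rev_exhaust)
termination
  by (relation "measure (length \<circ> snd)") (auto intro: le_less_trans[OF length_filter_le])

definition perm_tree :: "nat \<Rightarrow> (nat \<times> nat) set \<Rightarrow> (nat \<Rightarrow> nat) \<Rightarrow> rtree" where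
  "perm_tree N E w = gtree E (one_line N w)"

definition tree_equiv :: "nat \<Rightarrow> (nat \<times> nat) set \<Rightarrow> ((nat \<Rightarrow> nat) \<times> (nat \<Rightarrow> nat)) set" where
  "tree_equiv N E =
     {(u, v). u permutes {1..N} \<and> v permutes {1..N} \<and> perm_tree N E u = perm_tree N E v}"

definition tree_classes :: "nat \<Rightarrow> (nat \<times> nat) set \<Rightarrow> (nat \<Rightarrow> nat) set set" where
  "tree_classes N E = {w. w permutes {1..N}} // tree_equiv N E"

definition class_min :: "nat \<Rightarrow> (nat \<Rightarrow> nat) set \<Rightarrow> nat \<Rightarrow> nat" where
  "class_min N C = (THE u. u \<in> C \<and> (\<forall>v\<in>C. weak_le N v u \<longrightarrow> v = u))"

definition class_max :: "nat \<Rightarrow> (nat \<Rightarrow> nat) set \<Rightarrow> nat \<Rightarrow> nat" where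
  "class_max N C = (THE u. u \<in> C \<and> (\<forall>v\<in>C. weak_le N u v \<longrightarrow> v = u))"

definition tub_le :: "nat \<Rightarrow> (nat \<Rightarrow> nat) set \<Rightarrow> (nat \<Rightarrow> nat) set \<Rightarrow> bool" where
  "tub_le N C D \<longleftrightarrow> weak_le N (class_min N C) (class_min N D)"

definition tub_cover ::
  "nat \<Rightarrow> (nat \<times> nat) set \<Rightarrow> (nat \<Rightarrow> nat) set \<Rightarrow> (nat \<Rightarrow> nat) set \<Rightarrow> bool" where
  "tub_cover N E C D \<longleftrightarrow>
     C \<in> tree_classes N E \<and> D \<in> tree_classes N E \<and> C \<noteq> D \<and> tub_le N C D \<and>
     (\<forall>X\<in>tree_classes N E. tub_le N C X \<and> tub_le N X D \<longrightarrow> X = C \<or> X = D)"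

definition tub_maxchains :: "nat \<Rightarrow> (nat \<times> nat) set \<Rightarrow> (nat \<Rightarrow> nat) set list set" where
  "tub_maxchains N E =
     {Cs. successively (tub_cover N E) Cs \<and>
          pred_on.maxchain (tree_classes N E) (tub_le N) (set Cs)}"

definition adj_cycle :: "nat \<Rightarrow> nat \<Rightarrow> nat \<Rightarrow> nat" where
  "adj_cycle a b i = (if i = a then b else if a < i \<and> i \<le> b then i - 1 else i)"

definition is_adj_cycle :: "(nat \<Rightarrow> nat) \<Rightarrow> bool" where
  "is_adj_cycle c \<longleftrightarrow> (\<exists>a b. 1 \<le> a \<and> a < b \<and> c = adj_cycle a b)"

definition chain_seq ::
  "nat \<Rightarrow> (nat \<Rightarrow> nat) set list \<Rightarrow> (nat \<Rightarrow> nat) list \<Rightarrow> bool" where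
  "chain_seq N Cs \<gamma> \<longleftrightarrow>
     length Cs = length \<gamma> + 1 \<and>
     (\<forall>k\<in>{1..length \<gamma>}. is_adj_cycle (\<gamma> ! (k - 1)) \<and>
        class_max N (Cs ! (k - 1)) \<circ> \<gamma> ! (k - 1) = class_max N (Cs ! k))"

definition SMR :: "nat \<Rightarrow> nat \<Rightarrow> (nat \<Rightarrow> nat) list set" where
  "SMR m n =
     {\<gamma>. \<exists>Cs \<in> tub_maxchains (m + n) (lollipop m n).
        (\<forall>Ds \<in> tub_maxchains (m + n) (lollipop m n). length Cs \<le> length Ds) \<and>
        chain_seq (m + n) Cs \<gamma>}"

definition word_Des :: "nat list \<Rightarrow> nat set" where
  "word_Des \<sigma> = {i. 1 \<le> i \<and> i < length \<sigma> \<and> \<sigma> ! (i - 1) > \<sigma> ! i}"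

text \<open>The parameters \<open>a < b\<close> of an adjacent cycle are determined by the permutation.\<close>

lemma adj_cycle_inject:
  assumes "a < b" "a' < b'" "adj_cycle a b = adj_cycle a' b'"
  shows "a = a' \<and> b = b'"
proof -
  have "adj_cycle a b i = adj_cycle a' b' i" for i
    using assms(3) by simp
  from this[of a] this[of a'] show ?thesis
    using assms(1,2) by (auto simp: adj_cycle_def split: if_splits)
qed

definition cycle_top :: "(nat \<Rightarrow> nat) \<Rightarrow> nat" where
  "cycle_top c = (THE b. \<exists>a. a < b \<and> c = adj_cycle a b)"

lemma cycle_top_adj_cycle: "a < b \<Longrightarrow> cycle_top (adj_cycle a b) = b"
  unfolding cycle_top_def by (rule the_equality) (auto dest: adj_cycle_inject)

definition cycle_Des :: "(nat \<Rightarrow> nat) list \<Rightarrow> nat set" where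
  "cycle_Des \<gamma> =
     {i. 1 \<le> i \<and> i < length \<gamma> \<and> cycle_top (\<gamma> ! (i - 1)) \<ge> cycle_top (\<gamma> ! i)}"

definition w_perm :: "nat \<Rightarrow> nat \<Rightarrow> nat \<Rightarrow> nat" where
  "w_perm m n = of_one_line ([m + n] @ rev [1..<m] @ [m..<m + n])"

definition big_positions :: "nat \<Rightarrow> nat \<Rightarrow> nat list \<Rightarrow> nat set" where
  "big_positions m n \<sigma> = {i \<in> {1..length \<sigma>}. \<sigma> ! (i - 1) \<in> {m..<m + n}}"

definition psi :: "nat \<Rightarrow> nat \<Rightarrow> nat list \<Rightarrow> (nat \<Rightarrow> nat) list" where
  "psi m n \<sigma> =
     map (\<lambda>i. let s = \<sigma> ! (i - 1); l = card {j \<in> big_positions m n \<sigma>. j < i}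
              in if i \<in> big_positions m n \<sigma> then adj_cycle (m + n - s) (m + n)
                 else adj_cycle (s + l) (s + l + 1))
         [1..<Suc (length \<sigma>)]"

end

theory Submission
  imports Defs
begin

text \<open>Write \<open>N = m + n\<close>. Reduced words of \<open>w_perm m n\<close> and shortest maximal chains of the tubing lattice
are shown to be labellings of the same walks, which start at the state \<open>(0, id)\<close> and end at
\<open>(n, rev_perm m)\<close>. A state is a pair of a number \<open>l \<le> n\<close> and a permutation \<open>r\<close> of \<open>{1..m}\<close> that
fixes \<open>m\<close> as long as \<open>l < n\<close>; a step either multiplies \<open>r\<close> by an adjacent transposition at an ascent
or increases \<open>l\<close> by one. These walks are the predicate \<open>path\<close>, and \<open>psi\<close> translates
the letters of a word into the cycles of a chain step by step.

For words this is direct: in a reduced word of \<open>w_perm m n\<close> every letter creates an inversion of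
\<open>w_perm m n\<close>, and all of these involve \<open>N\<close> or two values below \<open>m\<close>. So the only moves are
those of \<open>N\<close> to the left, by one position for each big letter, and those within the first \<open>m\<close>
positions (\<open>ascent_word_imp_path\<close>).

For chains, weak order is inclusion of the sets \<open>invs\<close> of inverted pairs of values. Two permutations
have the same tree iff they agree on which values are descendants of which others, and the
swaps that preserve the tree exchange neighbours \<open>x < z\<close> that are separated by a later \<open>y \<ge> m\<close>
with \<open>x < y < z\<close>. Hence the maximal element of a class is its unique member that avoids the
pattern 132 with "2" at least \<open>m\<close>, and classes compare like their maximal elements
(\<open>tub_le_iff\<close>). A cover of such a permutation takes an ascent \<open>x, z\<close>, moves \<open>z\<close> in front of \<open>x\<close>, and,
if \<open>x \<ge> m\<close>, further past the whole run of entries below \<open>x\<close>, as avoidance forces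
(\<open>tub_cover_iff_jump\<close>). So maximal chains are sequences of jumps from the identity to the reverse
permutation.

The number of inversions among \<open>1, \<dots>, m\<close> plus the number of values above \<open>m\<close> that have already moved
grows by at most one with every jump. Chains that attain this bound are those in which every value
above \<open>m\<close> moves only once, and then passes all smaller values at the same time. If \<open>z\<close> has moved
before \<open>z + 1\<close>, then \<open>z + 1\<close> cannot pass everything in one jump; so the values above \<open>m\<close> move in the
order \<open>N, N - 1, \<dots>, m + 1\<close>, and \<open>m\<close> does not move before \<open>m + 1\<close>. All permutations on such a chain
therefore have the form \<open>N, \<dots>, N - l + 1, r(1), \<dots>, r(m), m + 1, \<dots>, N - l\<close> for a state \<open>(l, r)\<close>
(\<open>tight_climb_is_path\<close>). Since walks to the final state exist, the bound is attained and the shortest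
maximal chains are exactly these.\<close>

section \<open>Inversions and the weak order\<close>

text \<open>Inversions are recorded as pairs of values, so that weak order becomes inclusion.\<close>

definition invs :: "nat \<Rightarrow> (nat \<Rightarrow> nat) \<Rightarrow> (nat \<times> nat) set" where
  "invs N u = {(x, z). 1 \<le> x \<and> x < z \<and> z \<le> N \<and> inv u z < inv u x}"

lemma adj_transp_eq_adj_cycle: "adj_transp i = adj_cycle i (i + 1)"
  by (auto simp: adj_transp_def adj_cycle_def transpose_def fun_eq_iff)

text \<open>The effect of right multiplication by \<open>adj_cycle a b\<close> on positions.\<close>

definition adj_cycle_inv :: "nat \<Rightarrow> nat \<Rightarrow> nat \<Rightarrow> nat" where
  "adj_cycle_inv a b i = (if i = b then a else if a \<le> i \<and> i < b then i + 1 else i)"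

lemma adj_cycle_inverse:
  assumes "a \<le> b"
  shows "adj_cycle a b (adj_cycle_inv a b i) = i" "adj_cycle_inv a b (adj_cycle a b i) = i"
  using assms by (auto simp: adj_cycle_def adj_cycle_inv_def)

lemma adj_cycle_permutes:
  assumes "1 \<le> a" "a \<le> b" "b \<le> N"
  shows "adj_cycle a b permutes {1..N}"
proof (rule bij_imp_permutes)
  show "bij_betw (adj_cycle a b) {1..N} {1..N}"
    by (rule bij_betwI[where g = "adj_cycle_inv a b"])
      (use assms in \<open>auto simp: adj_cycle_inverse\<close>, (auto simp: adj_cycle_def adj_cycle_inv_def))
qed (use assms in \<open>auto simp: adj_cycle_def\<close>)

lemma adj_cycle_inv_less:
  assumes "a \<le> b" "q \<noteq> p"
  shows "adj_cycle_inv a b q < adj_cycle_inv a b p \<longleftrightarrow>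
    (if q = b then a \<le> p else if p = b then q < a else q < p)"
  using assms by (auto simp: adj_cycle_inv_def)

lemma inv_adj_cycle:
  assumes "a \<le> b"
  shows "inv (adj_cycle a b) = adj_cycle_inv a b"
  by (rule inv_unique_comp) (auto simp: fun_eq_iff adj_cycle_inverse assms)

lemma inv_comp_adj_cycle:
  assumes "u permutes {1..N}" "1 \<le> a" "a \<le> b" "b \<le> N"
  shows "inv (u \<circ> adj_cycle a b) y = adj_cycle_inv a b (inv u y)"
proof -
  have "bij u" "bij (adj_cycle a b)"
    using assms adj_cycle_permutes permutes_bij by blast+
  then have "inv (u \<circ> adj_cycle a b) = inv (adj_cycle a b) \<circ> inv u"
    by (rule o_inv_distrib)
  with inv_adj_cycle[OF assms(3)] show ?thesis
    by simp
qed

lemma permutes_pos: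
  assumes "u permutes {1..N}"
  shows "inv u (u i) = i" "u (inv u x) = x" "u i = x \<longleftrightarrow> i = inv u x"
    "inv u x = inv u y \<longleftrightarrow> x = y" "u i = u j \<longleftrightarrow> i = j"
    "u i \<in> {1..N} \<longleftrightarrow> i \<in> {1..N}" "inv u x \<in> {1..N} \<longleftrightarrow> x \<in> {1..N}"
  using assms permutes_inverses[OF assms] permutes_in_image[OF assms]
    permutes_in_image[OF permutes_inv[OF assms]] by (auto, metis+)

lemma invs_positions:
  assumes "u permutes {1..N}" "i \<in> {1..N}" "j \<in> {1..N}"
  shows "(u i, u j) \<in> invs N u \<longleftrightarrow> u i < u j \<and> j < i"
  using assms permutes_pos(6)[OF assms(1)] by (auto simp: invs_def permutes_pos(1)[OF assms(1)])

text \<open>The entry at position \<open>b\<close> travels left past the entries at positions \<open>a, \<dots>, b - 1\<close>; as these are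
smaller, precisely the pairs it passes become inverted.\<close>

lemma invs_comp_adj_cycle:
  assumes u: "u permutes {1..N}" and ab: "1 \<le> a" "a \<le> b" "b \<le> N"
    and less: "\<And>i. a \<le> i \<Longrightarrow> i < b \<Longrightarrow> u i < u b"
  shows "invs N (u \<circ> adj_cycle a b) = invs N u \<union> {(u i, u b) | i. a \<le> i \<and> i < b}"
proof -
  have "((x, z) \<in> invs N (u \<circ> adj_cycle a b)) \<longleftrightarrow>
      (x, z) \<in> invs N u \<or> (\<exists>i. x = u i \<and> z = u b \<and> a \<le> i \<and> i < b)" for x z
  proof -
    have 1: "u i \<in> {1..N}" if "a \<le> i" "i \<le> b" for i
      using that ab permutes_pos(6)[OF u] by auto
    have 2: "(\<exists>i. x = u i \<and> z = u b \<and> a \<le> i \<and> i < b) \<longleftrightarrow> inv u z = b \<and> a \<le> inv u x \<and> inv u x < b"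
      using permutes_pos[OF u] by metis
    have 3: "inv u z = b \<and> a \<le> inv u x \<and> inv u x < b \<Longrightarrow> 1 \<le> x \<and> x < z \<and> z \<le> N"
      using 1[of b] 1[of "inv u x"] less[of "inv u x"] permutes_pos(2)[OF u] ab by auto
    have 4: "x < z \<Longrightarrow> inv u x = b \<Longrightarrow> a \<le> inv u z \<Longrightarrow> \<not> inv u z < b"
      using less[of "inv u z"] permutes_pos(2)[OF u] by force
    have 5: "x < z \<Longrightarrow> inv u z \<noteq> inv u x"
      using permutes_pos(4)[OF u] by simp
    have 6: "x < z \<Longrightarrow> adj_cycle_inv a b (inv u z) < adj_cycle_inv a b (inv u x) \<longleftrightarrow>
        inv u z < inv u x \<or> inv u z = b \<and> a \<le> inv u x \<and> inv u x < b"
      using adj_cycle_inv_less[OF ab(2) 5] 4 5 ab(2)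
      by (cases "inv u z = b"; cases "inv u x = b") (simp, simp, linarith, simp, linarith, simp)
    show ?thesis
      unfolding 2 using 3 6 by (auto simp: invs_def inv_comp_adj_cycle[OF u ab])
  qed
  then show ?thesis
    by auto
qed

lemma invs_comp_adj_transp:
  assumes "u permutes {1..N}" "i \<in> {1..<N}" "u i < u (i + 1)"
  shows "invs N (u \<circ> adj_transp i) = insert (u i, u (i + 1)) (invs N u)"
proof -
  have "{(u j, u (i+1)) | j. i \<le> j \<and> j < i + 1} = {(u i, u (i+1))}"
    by auto (metis le_less_Suc_eq)
  moreover have "invs N (u \<circ> adj_cycle i (i+1)) = invs N u \<union> {(u j, u (i+1)) | j. i \<le> j \<and> j < i + 1}"
  proof (rule invs_comp_adj_cycle)
    show "u j < u (i + 1)" if "i \<le> j" "j < i + 1" for j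
      using that assms(3) by (cases "j = i") auto
  qed (use assms in auto)
  ultimately show ?thesis
    by (simp add: adj_transp_eq_adj_cycle)
qed

lemma finite_invs: "finite (invs N u)"
  by (rule finite_subset[of _ "{1..N} \<times> {1..N}"]) (auto simp: invs_def)

lemma adj_transp_permutes: "i \<in> {1..<N} \<Longrightarrow> adj_transp i permutes {1..N}"
  using adj_cycle_permutes[of i "i + 1" N] by (simp add: adj_transp_eq_adj_cycle)

lemma increasing_permutes_id:
  fixes p :: "nat \<Rightarrow> nat"
  assumes "p permutes {1..N}" "\<And>i. i \<in> {1..<N} \<Longrightarrow> p i < p (i + 1)"
  shows "p = id"
proof (rule permutes_natset_ge[OF assms(1)])
  have "1 \<le> i \<Longrightarrow> i \<le> N \<Longrightarrow> i \<le> p i" for i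
  proof (induction i)
    case (Suc i)
    show ?case
    proof (cases "i = 0")
      case True
      then show ?thesis using permutes_pos(6)[OF assms(1), of 1] Suc by simp
    next
      case False
      then show ?thesis using Suc assms(2)[of i] by fastforce
    qed
  qed simp
  then show "\<forall>i\<in>{1..N}. i \<le> p i"
    by simp
qed

text \<open>If \<open>v\<close> inverts none of the adjacent ascents of \<open>u\<close>, then \<open>v\<close> lists any two neighbours of \<open>u\<close> in the
same order as \<open>u\<close>, and so \<open>inv v \<circ> u\<close> is increasing.\<close>

lemma invs_subset_ascent:
  assumes u: "u permutes {1..N}" and v: "v permutes {1..N}"
    and sub: "invs N u \<subseteq> invs N v" and "u \<noteq> v"
  obtains i where "i \<in> {1..<N}" "u i < u (i + 1)" "(u i, u (i + 1)) \<in> invs N v"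
proof (rule ccontr)
  note found = that
  assume no: "\<not> thesis"
  have none: "\<not> (u i < u (i + 1) \<and> (u i, u (i + 1)) \<in> invs N v)" if i: "i \<in> {1..<N}" for i
  proof
    assume "u i < u (i + 1) \<and> (u i, u (i + 1)) \<in> invs N v"
    then have thesis
      using i found by simp
    with no show False ..
  qed
  have step: "(inv v \<circ> u) i < (inv v \<circ> u) (i + 1)" if i: "i \<in> {1..<N}" for i
  proof -
    have in_N: "u i \<in> {1..N}" "u (i + 1) \<in> {1..N}"
      using i permutes_pos(6)[OF u] by auto
    show ?thesis
    proof (cases "u i < u (i + 1)")
      case True
      with none[OF i] in_N have "\<not> inv v (u (i + 1)) < inv v (u i)"
        by (auto simp: invs_def)
      moreover have "inv v (u i) \<noteq> inv v (u (i + 1))"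
        using True permutes_pos(4)[OF v, of "u i" "u (i + 1)"] by simp
      ultimately show ?thesis
        by simp
    next
      case False
      moreover have "u i \<noteq> u (i + 1)"
        using permutes_pos(5)[OF u] by (metis Suc_eq_plus1 n_not_Suc_n)
      ultimately have "u (i + 1) < u i"
        by linarith
      moreover have "i + 1 \<in> {1..N}" "i \<in> {1..N}"
        using i by auto
      ultimately have "(u (i + 1), u i) \<in> invs N u"
        using invs_positions[OF u, of "i + 1" i] by linarith
      with sub have "(u (i + 1), u i) \<in> invs N v" ..
      then show ?thesis
        unfolding invs_def comp_apply by blast
    qed
  qed
  have "inv v \<circ> u = id"
    by (rule increasing_permutes_id[OF permutes_compose[OF u permutes_inv[OF v]] step])
  then have "inv v (u i) = i" for i
    by (metis comp_apply id_apply)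
  then have "u = v"
    using permutes_pos(2)[OF v] by (intro ext) metis
  with \<open>u \<noteq> v\<close> show False ..
qed

lemma invs_inject:
  assumes "u permutes {1..N}" "v permutes {1..N}" "invs N u = invs N v"
  shows "u = v"
proof (rule ccontr)
  assume "u \<noteq> v"
  then obtain i where "i \<in> {1..<N}" "u i < u (i + 1)" "(u i, u (i + 1)) \<in> invs N u"
    using invs_subset_ascent[OF assms(1,2)] assms(3) by blast
  then show False
    using invs_positions[OF assms(1), of i "i + 1"] by auto
qed

lemma invs_subset_imp_weak_le:
  assumes "u permutes {1..N}" "v permutes {1..N}" "invs N u \<subseteq> invs N v"
  shows "weak_le N u v"
  using assms
proof (induction "card (invs N v - invs N u)" arbitrary: u rule: less_induct)
  case less
  note u = \<open>u permutes {1..N}\<close> and v = \<open>v permutes {1..N}\<close>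
  show ?case
  proof (cases "u = v")
    case True
    then show ?thesis by (simp add: weak_le_def)
  next
    case False
    then obtain i where i: "i \<in> {1..<N}" "u i < u (i + 1)" "(u i, u (i + 1)) \<in> invs N v"
      using invs_subset_ascent[OF u v less.prems(3)] by blast
    let ?u = "u \<circ> adj_transp i"
    have new: "invs N ?u = insert (u i, u (i + 1)) (invs N u)"
      by (rule invs_comp_adj_transp[OF u i(1,2)])
    have "(u i, u (i + 1)) \<notin> invs N u"
      using invs_positions[OF u, of i "i + 1"] i by auto
    then have "invs N v - invs N ?u \<subset> invs N v - invs N u"
      using new i(3) by auto
    then have "card (invs N v - invs N ?u) < card (invs N v - invs N u)"
      by (intro psubset_card_mono) (simp_all add: finite_invs)
    moreover have "?u permutes {1..N}"
      by (rule permutes_compose[OF adj_transp_permutes[OF i(1)] u])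
    ultimately have "weak_le N ?u v"
      using less new i(3) by auto
    moreover have "weak_cover N u ?u"
      using u i by (auto simp: weak_cover_def)
    ultimately show ?thesis
      unfolding weak_le_def by (simp add: converse_rtranclp_into_rtranclp)
  qed
qed

lemma weak_le_imp_invs_subset:
  assumes "weak_le N u v"
  shows "invs N u \<subseteq> invs N v"
  using assms unfolding weak_le_def
  by (induction rule: rtranclp_induct) (auto simp: weak_cover_def invs_comp_adj_transp)

lemma weak_le_iff_invs_subset:
  assumes "u permutes {1..N}" "v permutes {1..N}"
  shows "weak_le N u v \<longleftrightarrow> invs N u \<subseteq> invs N v"
  using invs_subset_imp_weak_le[OF assms] weak_le_imp_invs_subset by blast

section \<open>Trees of the lollipop graph\<close>

lemma component_refl: "v \<in> S \<Longrightarrow> v \<in> component E S v"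
  by (simp add: component_def)

lemma component_subset: "component E S v \<subseteq> S"
  by (auto simp: component_def)

lemma component_step:
  "w \<in> component E S v \<Longrightarrow> v \<in> S \<Longrightarrow> (w, x) \<in> E \<Longrightarrow> x \<in> S \<Longrightarrow> x \<in> component E S v"
  by (auto simp: component_def intro: rtrancl_into_rtrancl)

lemma component_mono:
  assumes "S \<subseteq> T"
  shows "component E S v \<subseteq> component E T v"
proof -
  have "(E \<inter> S \<times> S)\<^sup>* \<subseteq> (E \<inter> T \<times> T)\<^sup>*"
    by (rule rtrancl_mono) (use assms in auto)
  then show ?thesis
    using assms by (auto simp: component_def)
qed

lemma component_eq:
  assumes "sym E" "w \<in> component E S v"
  shows "component E S w = component E S v"
proof -
  have vw: "(v, w) \<in> (E \<inter> S \<times> S)\<^sup>*"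
    using assms(2) by (simp add: component_def)
  have "sym (E \<inter> S \<times> S)"
    using assms(1) by (auto simp: sym_def)
  then have "(w, v) \<in> (E \<inter> S \<times> S)\<^sup>*"
    using vw by (meson sym_rtrancl symD)
  with vw show ?thesis
    by (auto simp: component_def intro: rtrancl_trans)
qed

text \<open>Within a smaller set a component never leaves the component of the larger set. This is why
passing to the subword of a component does not change descendants.\<close>

lemma component_restrict:
  assumes "S \<subseteq> T" "z \<in> S"
  shows "component E (S \<inter> component E T z) z = component E S z"
proof
  show "component E (S \<inter> component E T z) z \<subseteq> component E S z"
    by (rule component_mono) auto
  have zT: "z \<in> T"
    using assms by auto
  show "component E S z \<subseteq> component E (S \<inter> component E T z) z"
  proof
    fix x assume "x \<in> component E S z"
    then have "(z, x) \<in> (E \<inter> S \<times> S)\<^sup>*"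
      by (simp add: component_def)
    then show "x \<in> component E (S \<inter> component E T z) z"
    proof (induction rule: rtrancl_induct)
      case base
      show ?case
        using assms zT by (intro component_refl IntI)
    next
      case (step w x)
      have "w \<in> component E T z"
        using step.IH component_subset by blast
      then have "x \<in> component E T z"
        using step.hyps assms zT by (blast intro: component_step)
      with step show ?case
        using assms zT by (intro component_step[OF step.IH]) (auto intro: component_refl)
    qed
  qed
qed

lemma component_connected:
  assumes "sym E" "w \<in> component E S v"
  shows "component E (component E S v) w = component E S v"
proof -
  have "w \<in> S"
    using assms(2) component_subset by blast
  then have "component E (S \<inter> component E S w) w = component E S w"
    by (intro component_restrict) auto
  moreover have "component E S w = component E S v"
    by (rule component_eq[OF assms])
  ultimately show ?thesis
    using component_subset[of E S v] by (simp add: inf.absorb2)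
qed

text \<open>The pairs \<open>(x, z)\<close> such that \<open>x\<close> lies in the subtree rooted at \<open>z\<close>, read off from the word without
building the tree: when \<open>z\<close> becomes a root, the entries after it have been deleted.\<close>

definition below :: "(nat \<times> nat) set \<Rightarrow> nat list \<Rightarrow> (nat \<times> nat) set" where
  "below E ws = {(x, z). \<exists>p q. ws = p @ z # q \<and> x \<in> component E (set (p @ [z])) z}"

lemma below_snoc:
  assumes "distinct (p @ [r])"
  shows "below E (p @ [r]) = below E p \<union> component E (set (p @ [r])) r \<times> {r}"
proof -
  have "(x, z) \<in> below E (p @ [r]) \<longleftrightarrow> (x, z) \<in> below E p \<union> component E (set (p @ [r])) r \<times> {r}" for x z
  proof -
    have "p @ [r] = p' @ z # q \<longleftrightarrow> (q = [] \<and> p' = p \<and> z = r) \<or> (\<exists>q'. q = q' @ [r] \<and> p = p' @ z # q')" for p' q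
      by (cases q rule: rev_cases) auto
    then show ?thesis
      by (auto simp: below_def)
  qed
  then show ?thesis
    by auto
qed

lemma below_filter_component:
  assumes E: "sym E" and "distinct p"
  shows "below E (filter (\<lambda>u. u \<in> component E (set p) v) p) =
    {(x, z) \<in> below E p. z \<in> component E (set p) v}"
proof -
  let ?K = "component E (set p) v"
  let ?f = "filter (\<lambda>u. u \<in> ?K)"
  have prefix: "component E (set (?f a @ [z])) z = component E (set (a @ [z])) z"
    if "p = a @ z # b" "z \<in> ?K" for a b z
  proof -
    have "set (?f a @ [z]) = set (a @ [z]) \<inter> ?K"
      using that by auto
    moreover have "?K = component E (set p) z"
      using component_eq[OF E that(2)] by simp
    ultimately have "set (?f a @ [z]) = set (a @ [z]) \<inter> component E (set p) z"
      by simp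
    moreover have "component E (set (a @ [z]) \<inter> component E (set p) z) z = component E (set (a @ [z])) z"
      by (rule component_restrict) (use that(1) in auto)
    ultimately show ?thesis
      by simp
  qed
  have "(x, z) \<in> below E (?f p) \<longleftrightarrow> (x, z) \<in> below E p \<and> z \<in> ?K" for x z
  proof
    assume "(x, z) \<in> below E (?f p)"
    then obtain a b where *: "?f p = a @ z # b" "x \<in> component E (set (a @ [z])) z"
      by (auto simp: below_def)
    have "z \<in> set (?f p)"
      using *(1) by simp
    then obtain c d where p: "p = c @ z # d" and z: "z \<in> ?K"
      using split_list[of z p] by auto
    have "?f c @ z # ?f d = a @ z # b"
      using p z *(1) by simp
    moreover have "z \<notin> set (?f c)" "z \<notin> set (?f d)"
      using \<open>distinct p\<close> p by auto
    ultimately have "?f c = a"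
      by (simp add: append_Cons_eq_iff)
    with p z have "p = c @ z # d" "?f c = a" "z \<in> ?K"
      by auto
    then show "(x, z) \<in> below E p \<and> z \<in> ?K"
      using prefix *(2) unfolding below_def by blast
  next
    assume asm: "(x, z) \<in> below E p \<and> z \<in> ?K"
    then obtain a b where *: "p = a @ z # b" "x \<in> component E (set (a @ [z])) z"
      by (auto simp: below_def)
    then have "?f p = ?f a @ z # ?f b"
      using asm by (metis filter.simps(2) filter_append)
    with * prefix[OF *(1)] asm show "(x, z) \<in> below E (?f p)"
      unfolding below_def by blast
  qed
  then show ?thesis
    by auto
qed

lemma below_imp_in_set: "(x, z) \<in> below E ws \<Longrightarrow> x \<in> set ws \<and> z \<in> set ws"
  using component_subset by (fastforce simp: below_def)

primrec labels :: "rtree \<Rightarrow> nat set" where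
  "labels (Node r ts) = insert r (\<Union> (fset (labels |`| ts)))"

primrec descendants :: "rtree \<Rightarrow> (nat \<times> nat) set" where
  "descendants (Node r ts) = labels (Node r ts) \<times> {r} \<union> \<Union> (fset (descendants |`| ts))"

lemma labels_gtree: "ws \<noteq> [] \<Longrightarrow> labels (gtree E ws) = set ws"
proof (induction E ws rule: gtree.induct)
  case (2 E ws r)
  let ?f = "\<lambda>v. filter (\<lambda>u. u \<in> component E (set ws) v) ws"
  have "labels (gtree E (?f v)) = set (?f v)" if "v \<in> set ws" for v
  proof (rule 2)
    show "v |\<in>| fset_of_list ws"
      using that by (simp add: fset_of_list_elem)
    show "?f v \<noteq> []"
      using component_refl[OF that, of E] that by (metis (mono_tags, lifting) filter_empty_conv)
  qed
  then have "(\<Union>v\<in>set ws. labels (gtree E (?f v))) = (\<Union>v\<in>set ws. set (?f v))"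
    by simp
  also have "\<dots> = set ws"
    using component_refl by fastforce
  finally show ?case
    by (simp add: fset_of_list.rep_eq image_image)
qed simp

text \<open>The tree determines the relation \<open>below\<close>.\<close>

lemma descendants_gtree:
  assumes "sym E"
  shows "ws \<noteq> [] \<Longrightarrow> distinct ws \<Longrightarrow> \<forall>v\<in>set ws. component E (set ws) v = set ws \<Longrightarrow>
    descendants (gtree E ws) = below E ws"
  using assms
proof (induction E ws rule: gtree.induct)
  case (2 E ws r)
  let ?K = "component E (set ws)"
  let ?f = "\<lambda>v. filter (\<lambda>u. u \<in> ?K v) ws"
  have sub: "descendants (gtree E (?f v)) = {(x, z) \<in> below E ws. z \<in> ?K v}" if v: "v \<in> set ws" for v
  proof -
    have set_f: "set (?f v) = ?K v"
      using component_subset by fastforce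
    have "component E (?K v) w = ?K v" if "w \<in> ?K v" for w
      by (rule component_connected[OF \<open>sym E\<close> that])
    moreover have "?f v \<noteq> []"
      using component_refl[OF v, of E] v by (metis (mono_tags, lifting) filter_empty_conv)
    ultimately have "descendants (gtree E (?f v)) = below E (?f v)"
      using 2 v set_f by (simp add: fset_of_list_elem)
    then show ?thesis
      using below_filter_component[OF \<open>sym E\<close>] 2 by simp
  qed
  have "descendants (gtree E (ws @ [r])) =
      labels (gtree E (ws @ [r])) \<times> {r} \<union> (\<Union>v\<in>set ws. descendants (gtree E (?f v)))"
    by (simp add: fset_of_list.rep_eq image_image)
  also have "\<dots> = set (ws @ [r]) \<times> {r} \<union> (\<Union>v\<in>set ws. {(x, z) \<in> below E ws. z \<in> ?K v})"
    by (subst labels_gtree) (use sub in auto)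
  also have "(\<Union>v\<in>set ws. {(x, z) \<in> below E ws. z \<in> ?K v}) = below E ws"
    using component_refl[of _ "set ws" E] below_imp_in_set[of _ _ E ws] by auto
  finally show ?case
    using below_snoc[OF 2(3)] 2(4) by (auto simp del: gtree.simps)
qed simp

text \<open>The relation \<open>below\<close> determines the tree: the root is the only element above all others, the
relation on the remaining letters is a restriction, and so the induction hypothesis applies to each
component.\<close>

lemma gtree_eqI:
  assumes "sym E"
  shows "distinct ws \<Longrightarrow> distinct ws' \<Longrightarrow> set ws = set ws' \<Longrightarrow>
    \<forall>v\<in>set ws. component E (set ws) v = set ws \<Longrightarrow> below E ws = below E ws' \<Longrightarrow>
    gtree E ws = gtree E ws'"
proof (induction "length ws" arbitrary: ws ws' rule: less_induct)
  case less
  show ?case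
  proof (cases ws rule: rev_cases)
    case Nil
    then show ?thesis using less.prems by simp
  next
    case (snoc p r)
    then obtain p' r' where ws': "ws' = p' @ [r']"
      using less.prems(3) by (cases ws' rule: rev_cases) auto
    have dist: "distinct (p @ [r])" "distinct (p' @ [r'])"
      using less.prems snoc ws' by simp_all
    have b: "below E ws = below E p \<union> set ws \<times> {r}" "below E ws' = below E p' \<union> set ws \<times> {r'}"
    proof -
      have "component E (set (p @ [r])) r = set ws" "component E (set (p' @ [r'])) r' = set ws"
        using less.prems(3,4) snoc ws' by (metis in_set_conv_decomp)+
      then show "below E ws = below E p \<union> set ws \<times> {r}" "below E ws' = below E p' \<union> set ws \<times> {r'}"
        using below_snoc[OF dist(1), of E] below_snoc[OF dist(2), of E] snoc ws' by simp_all
    qed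
    have "r' = r"
    proof (rule ccontr)
      assume "r' \<noteq> r"
      have "r \<in> set ws"
        using snoc by simp
      then have "(r, r') \<in> below E ws"
        unfolding less.prems(5) b(2) by simp
      with \<open>r' \<noteq> r\<close> have "(r, r') \<in> below E p"
        unfolding b(1) by simp
      then have "r \<in> set p"
        by (simp add: below_imp_in_set)
      with dist(1) show False
        by simp
    qed
    have set_p: "set p = set p'"
      using less.prems(3) snoc ws' dist \<open>r' = r\<close> by auto
    have "below E p = {(x, z) \<in> below E ws. z \<noteq> r}"
      using b below_imp_in_set[of _ _ E p] dist by auto
    moreover have "below E p' = {(x, z) \<in> below E ws'. z \<noteq> r}"
      using b below_imp_in_set[of _ _ E p'] dist \<open>r' = r\<close> by auto
    ultimately have below_p: "below E p = below E p'"
      using less.prems by simp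
    let ?K = "component E (set p)"
    have "gtree E (filter (\<lambda>u. u \<in> ?K v) p) = gtree E (filter (\<lambda>u. u \<in> ?K v) p')" if v: "v \<in> set p" for v
    proof (rule less.hyps)
      show "length (filter (\<lambda>u. u \<in> ?K v) p) < length ws"
        using snoc by (simp add: le_imp_less_Suc)
      show "below E (filter (\<lambda>u. u \<in> ?K v) p) = below E (filter (\<lambda>u. u \<in> ?K v) p')"
        using below_filter_component[OF assms, of p v] below_filter_component[OF assms, of p' v]
          below_p set_p dist by simp
      have set_f: "set (filter (\<lambda>u. u \<in> ?K v) p) = ?K v"
        using component_subset by fastforce
      have "component E (?K v) w = ?K v" if "w \<in> ?K v" for w
        by (rule component_connected[OF assms that])
      then show "\<forall>w\<in>set (filter (\<lambda>u. u \<in> ?K v) p).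
          component E (set (filter (\<lambda>u. u \<in> ?K v) p)) w = set (filter (\<lambda>u. u \<in> ?K v) p)"
        unfolding set_f by blast
    qed (use dist set_p in auto)
    then show ?thesis
      unfolding snoc ws' \<open>r' = r\<close> using set_p
      by (simp add: fset_eq_iff fset_of_list.rep_eq)
  qed
qed

lemma gtree_eq_iff_below:
  assumes "sym E" "distinct ws" "distinct ws'" "set ws = set ws'"
    "\<forall>v\<in>set ws. component E (set ws) v = set ws"
  shows "gtree E ws = gtree E ws' \<longleftrightarrow> below E ws = below E ws'"
proof (cases "ws = []")
  case True
  with assms(4) show ?thesis by simp
next
  case False
  then have "ws' \<noteq> []"
    using assms(4) by auto
  with False have "descendants (gtree E ws) = below E ws" "descendants (gtree E ws') = below E ws'"
    using assms by (simp_all add: descendants_gtree)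
  then show ?thesis
    using gtree_eqI[OF assms] by metis
qed

lemma sym_lollipop: "sym (lollipop m n)"
  by (auto simp: sym_def lollipop_def)

text \<open>Two vertices can be connected in the lollipop inside \<open>S\<close> unless a vertex \<open>y \<ge> m\<close> strictly between
them is missing: no edge crosses such a \<open>y\<close>, since the ends of an edge are consecutive or both at
most \<open>m\<close>.\<close>

lemma component_lollipop:
  assumes S: "S \<subseteq> {1..m + n}" and v: "v \<in> S"
  shows "component (lollipop m n) S v =
    {u \<in> S. \<forall>y. m \<le> y \<and> (u < y \<and> y < v \<or> v < y \<and> y < u) \<longrightarrow> y \<in> S}"
    (is "?C v = ?D")
proof
  show "?C v \<subseteq> ?D"
  proof clarsimp
    fix u assume "u \<in> ?C v"
    then have uS: "u \<in> S" and path: "(v, u) \<in> (lollipop m n \<inter> S \<times> S)\<^sup>*"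
      by (auto simp: component_def)
    moreover have "y \<in> S" if y: "m \<le> y" "u < y \<and> y < v \<or> v < y \<and> y < u" for y
    proof (rule ccontr)
      assume "y \<notin> S"
      from path have "u < y \<longleftrightarrow> v < y"
      proof (induction rule: rtrancl_induct)
        case (step a b)
        then have "a \<noteq> y" "b \<noteq> y"
          using \<open>y \<notin> S\<close> by auto
        with step y(1) show ?case
          by (auto simp: lollipop_def)
      qed simp
      with y show False
        by auto
    qed
    ultimately show "u \<in> S \<and> (\<forall>y. m \<le> y \<and> (u < y \<and> y < v \<or> v < y \<and> y < u) \<longrightarrow> y \<in> S)"
      by blast
  qed
next
  have up: "u \<in> ?C v" if "u \<in> S" "v \<in> S" "u < v" "\<And>y. m \<le> y \<Longrightarrow> u < y \<Longrightarrow> y < v \<Longrightarrow> y \<in> S" for u v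
    using that
  proof (induction v)
    case (Suc v)
    show ?case
    proof (cases "Suc v \<le> m \<or> v = u")
      case True
      then have "(Suc v, u) \<in> lollipop m n"
        using Suc.prems S by (auto simp: lollipop_def)
      then show ?thesis
        using component_step[OF component_refl] Suc.prems by blast
    next
      case False
      then have *: "u < v" "m \<le> v" "v \<in> S"
        using Suc.prems by auto
      then have "u \<in> ?C v"
        using Suc by auto
      moreover have "(Suc v, v) \<in> lollipop m n"
        using * Suc.prems S by (auto simp: lollipop_def)
      then have "v \<in> ?C (Suc v)"
        using component_step[OF component_refl] Suc.prems * by blast
      ultimately show ?thesis
        using component_eq[OF sym_lollipop] by blast
    qed
  qed simp
  show "?D \<subseteq> ?C v"
  proof
    fix u assume "u \<in> ?D"
    then have u: "u \<in> S" "\<And>y. m \<le> y \<Longrightarrow> (u < y \<and> y < v \<or> v < y \<and> y < u) \<Longrightarrow> y \<in> S"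
      by auto
    consider "u = v" | "u < v" | "v < u"
      by linarith
    then show "u \<in> ?C v"
    proof cases
      case 1
      then show ?thesis using component_refl[OF v] by simp
    next
      case 2
      then show ?thesis using up u v by blast
    next
      case 3
      then have "v \<in> ?C u"
        using up u v by blast
      then show ?thesis
        using component_eq[OF sym_lollipop] component_refl[OF u(1)] by blast
    qed
  qed
qed

text \<open>The descendant relation of the tree of \<open>u\<close> for the lollipop, in terms of positions: \<open>x\<close> is below \<open>z\<close>
if it comes earlier and every separator of the two comes before \<open>z\<close>.\<close>

definition tree_below :: "nat \<Rightarrow> nat \<Rightarrow> (nat \<Rightarrow> nat) \<Rightarrow> (nat \<times> nat) set" where
  "tree_below m N u = {(x, z). x \<in> {1..N} \<and> z \<in> {1..N} \<and> inv u x \<le> inv u z \<and>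
     (\<forall>y. m \<le> y \<and> (x < y \<and> y < z \<or> z < y \<and> y < x) \<longrightarrow> inv u y < inv u z)}"

lemma below_one_line:
  assumes u: "u permutes {1..m + n}"
  shows "below (lollipop m n) (one_line (m + n) u) = tree_below m (m + n) u"
proof -
  let ?N = "m + n"
  let ?E = "lollipop m n"
  have decomp: "(\<exists>p q. one_line ?N u = p @ z # q \<and> x \<in> component ?E (set (p @ [z])) z) \<longleftrightarrow>
      z \<in> {1..?N} \<and> x \<in> component ?E (u ` {1..inv u z}) z" for x z
  proof -
    have take: "set (take k (one_line ?N u) @ [u (Suc k)]) = u ` {1..Suc k}" if "k < ?N" for k
    proof -
      have "take k (one_line ?N u) = map u [1..<Suc k]"
        using that unfolding one_line_def by (simp add: take_map take_upt del: upt_Suc)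
      then show ?thesis
        by (simp add: atLeastLessThanSuc_atLeastAtMost atLeastAtMostSuc_conv del: upt_Suc)
    qed
    show ?thesis
    proof
      assume "\<exists>p q. one_line ?N u = p @ z # q \<and> x \<in> component ?E (set (p @ [z])) z"
      then obtain p q where *: "one_line ?N u = p @ z # q" "x \<in> component ?E (set (p @ [z])) z"
        by blast
      have k: "length p < ?N"
        using arg_cong[OF *(1), of length] by (simp add: one_line_def del: upt_Suc)
      have z: "z = u (Suc (length p))"
        using arg_cong[OF *(1), of "\<lambda>l. l ! length p"] k by (simp add: one_line_def del: upt_Suc)
      have p: "p = take (length p) (one_line ?N u)"
        using * by simp
      have "set (p @ [z]) = u ` {1..Suc (length p)}"
        using take[OF k] p z by metis
      moreover have "inv u z = Suc (length p)" "z \<in> {1..?N}"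
        using z k permutes_pos(1,6)[OF u] by auto
      ultimately show "z \<in> {1..?N} \<and> x \<in> component ?E (u ` {1..inv u z}) z"
        using *(2) by simp
    next
      assume *: "z \<in> {1..?N} \<and> x \<in> component ?E (u ` {1..inv u z}) z"
      then have "inv u z \<in> {1..?N}"
        using permutes_pos(7)[OF u] by blast
      then obtain k where k: "inv u z = Suc k" "k < ?N"
        by (cases "inv u z") auto
      have z: "z = u (Suc k)"
        using k(1) permutes_pos(2)[OF u] by metis
      let ?l = "one_line ?N u"
      have "?l = take k ?l @ ?l ! k # drop (Suc k) ?l"
        using k(2) by (intro id_take_nth_drop) (simp add: one_line_def del: upt_Suc)
      moreover have "?l ! k = z"
        using k z by (simp add: one_line_def del: upt_Suc)
      moreover have "set (take k ?l @ [z]) = u ` {1..inv u z}"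
        using take[OF k(2)] k z by simp
      ultimately show "\<exists>p q. ?l = p @ z # q \<and> x \<in> component ?E (set (p @ [z])) z"
        using * by metis
    qed
  qed
  have "x \<in> component ?E (u ` {1..inv u z}) z \<longleftrightarrow> (x, z) \<in> tree_below m ?N u" if z: "z \<in> {1..?N}" for x z
  proof -
    define S where "S = u ` {1..inv u z}"
    have mem: "y \<in> S \<longleftrightarrow> y \<in> {1..?N} \<and> inv u y \<le> inv u z" for y
    proof -
      have "y \<in> S \<longleftrightarrow> inv u y \<in> {1..inv u z}"
        unfolding S_def using permutes_pos(1,2)[OF u] by (metis image_iff)
      also have "\<dots> \<longleftrightarrow> inv u y \<in> {1..?N} \<and> inv u y \<le> inv u z"
        using permutes_pos(7)[OF u, of z] z by auto
      also have "\<dots> \<longleftrightarrow> y \<in> {1..?N} \<and> inv u y \<le> inv u z"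
        by (simp only: permutes_pos(7)[OF u])
      finally show ?thesis .
    qed
    have comp: "component ?E S z =
      {x \<in> S. \<forall>y. m \<le> y \<and> (x < y \<and> y < z \<or> z < y \<and> y < x) \<longrightarrow> y \<in> S}"
      by (rule component_lollipop) (use mem z in auto)
    have "y \<in> S \<longleftrightarrow> inv u y < inv u z"
      if "x \<in> {1..?N}" "x < y \<and> y < z \<or> z < y \<and> y < x" for y
    proof -
      have "inv u y \<noteq> inv u z"
        using that(2) permutes_pos(4)[OF u, of y z] by auto
      then show ?thesis
        unfolding mem using that z by auto
    qed
    then show ?thesis
      using z mem[of x] unfolding S_def[symmetric] unfolding comp by (auto simp: tree_below_def)
  qed
  then have "(x, z) \<in> below ?E (one_line ?N u) \<longleftrightarrow> (x, z) \<in> tree_below m ?N u" for x z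
    unfolding below_def using decomp by (auto simp: tree_below_def)
  then show ?thesis
    by auto
qed

lemma tree_equiv_iff:
  assumes "m \<ge> 1"
  shows "(u, v) \<in> tree_equiv (m + n) (lollipop m n) \<longleftrightarrow>
    u permutes {1..m + n} \<and> v permutes {1..m + n} \<and> tree_below m (m + n) u = tree_below m (m + n) v"
proof (cases "u permutes {1..m + n} \<and> v permutes {1..m + n}")
  case True
  then have u: "u permutes {1..m + n}" and v: "v permutes {1..m + n}"
    by auto
  have set_line: "set (one_line (m + n) w) = {1..m + n}" "distinct (one_line (m + n) w)"
    if w: "w permutes {1..m + n}" for w
  proof -
    have "set [1..<Suc (m + n)] = {1..m + n}"
      by (auto simp del: upt_Suc)
    then show "set (one_line (m + n) w) = {1..m + n}" "distinct (one_line (m + n) w)"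
      unfolding one_line_def distinct_map set_map
      by (simp_all only: permutes_image[OF w] permutes_inj_on[OF w] distinct_upt simp_thms)
  qed
  have "component (lollipop m n) {1..m + n} v = {1..m + n}" if "v \<in> {1..m + n}" for v
    unfolding component_lollipop[OF order_refl that] using that assms by auto
  then have "gtree (lollipop m n) (one_line (m + n) u) = gtree (lollipop m n) (one_line (m + n) v) \<longleftrightarrow>
      below (lollipop m n) (one_line (m + n) u) = below (lollipop m n) (one_line (m + n) v)"
    using set_line[OF u] set_line[OF v] by (intro gtree_eq_iff_below[OF sym_lollipop]) simp_all
  then show ?thesis
    unfolding below_one_line[OF u] below_one_line[OF v] using u v
    by (simp add: tree_equiv_def perm_tree_def)
qed (auto simp: tree_equiv_def)

section \<open>Maxima and minima of tree classes\<close>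

text \<open>Only patterns whose letter "2", the last entry \<open>u k\<close>, is at least \<open>m\<close> are forbidden, since only
these vertices separate the lollipop.\<close>

definition avoids_132 :: "nat \<Rightarrow> nat \<Rightarrow> (nat \<Rightarrow> nat) \<Rightarrow> bool" where
  "avoids_132 m N u \<longleftrightarrow>
    (\<forall>i j k. 1 \<le> i \<and> i < j \<and> j < k \<and> k \<le> N \<and> m \<le> u k \<longrightarrow> \<not> (u i < u k \<and> u k < u j))"

definition avoids_312 :: "nat \<Rightarrow> nat \<Rightarrow> (nat \<Rightarrow> nat) \<Rightarrow> bool" where
  "avoids_312 m N u \<longleftrightarrow>
    (\<forall>i j k. 1 \<le> i \<and> i < j \<and> j < k \<and> k \<le> N \<and> m \<le> u k \<longrightarrow> \<not> (u j < u k \<and> u k < u i))"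

lemma tree_below_imp_invs:
  assumes "u permutes {1..N}" "x < z"
  shows "(x, z) \<in> tree_below m N u \<Longrightarrow> (x, z) \<notin> invs N u"
    and "(z, x) \<in> tree_below m N u \<Longrightarrow> (x, z) \<in> invs N u"
  using assms permutes_pos(4)[OF assms(1), of x z] by (auto simp: tree_below_def invs_def)

text \<open>Two words that differ only in the relative order of \<open>p\<close> and \<open>q\<close> have the same descendants if
\<open>p\<close> and \<open>q\<close> are separated by a later \<open>y\<close>. A pair whose status could be affected is also separated
by \<open>y\<close>, so it is not related at all.\<close>

lemma tree_below_subset_if_incomparable:
  assumes agree: "\<And>a b. {a, b} \<noteq> {p, q} \<Longrightarrow> inv u a < inv u b \<longleftrightarrow> inv v a < inv v b"
    and y: "p < y" "y < q" "m \<le> y" "inv u p < inv u y" "inv u q < inv u y"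
  shows "tree_below m N u \<subseteq> tree_below m N v"
proof clarify
  fix x z assume xz: "(x, z) \<in> tree_below m N u"
  then have z: "x \<in> {1..N}" "z \<in> {1..N}" "inv u x \<le> inv u z"
    and before: "\<And>w. m \<le> w \<Longrightarrow> x < w \<and> w < z \<or> z < w \<and> w < x \<Longrightarrow> inv u w < inv u z"
    by (auto simp: tree_below_def)
  have no_sep: False if "z = q \<and> x \<le> p \<or> z = p \<and> q \<le> x"
    using that before[of y] y by auto
  have "inv v x \<le> inv v z"
    using agree[of z x] z(3) no_sep by (metis doubleton_eq_iff leI leD order_refl)
  moreover have "inv v w < inv v z" if "m \<le> w" "x < w \<and> w < z \<or> z < w \<and> w < x" for w
  proof (cases "{w, z} = {p, q}")
    case True
    then show ?thesis
      using no_sep that y by (auto simp: doubleton_eq_iff)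
  next
    case False
    then show ?thesis
      using agree before that by blast
  qed
  ultimately show "(x, z) \<in> tree_below m N v"
    using z by (auto simp: tree_below_def)
qed

lemma tree_below_swap:
  assumes u: "u permutes {1..N}" and i: "1 \<le> i" "i + 1 < k" "k \<le> N"
    and vals: "u i < u k" "u k < u (i + 1)" "m \<le> u k"
  shows "tree_below m N (u \<circ> adj_transp i) = tree_below m N u"
proof -
  let ?v = "u \<circ> adj_transp i"
  have inv_v: "inv ?v a = adj_cycle_inv i (i + 1) (inv u a)" for a
    using inv_comp_adj_cycle[OF u, of i "i + 1"] i by (simp add: adj_transp_eq_adj_cycle)
  have agree: "inv u a < inv u b \<longleftrightarrow> inv ?v a < inv ?v b" if "{a, b} \<noteq> {u i, u (i + 1)}" for a b
  proof -
    have "\<not> (inv u a = i \<and> inv u b = i + 1)" "\<not> (inv u a = i + 1 \<and> inv u b = i)"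
      using that permutes_pos(2)[OF u, of a] permutes_pos(2)[OF u, of b] by auto
    then show ?thesis
      unfolding inv_v adj_cycle_inv_def by auto
  qed
  have k: "{u i, u k} \<noteq> {u i, u (i + 1)}" "{u (i + 1), u k} \<noteq> {u i, u (i + 1)}"
    using vals by (auto simp: doubleton_eq_iff)
  have pos: "inv u (u i) < inv u (u k)" "inv u (u (i + 1)) < inv u (u k)"
    using i by (simp_all add: permutes_pos(1)[OF u])
  show ?thesis
  proof
    show "tree_below m N u \<subseteq> tree_below m N ?v"
      by (rule tree_below_subset_if_incomparable[OF agree vals pos])
    have pos': "inv ?v (u i) < inv ?v (u k)" "inv ?v (u (i + 1)) < inv ?v (u k)"
      using agree[OF k(1)] agree[OF k(2)] pos by auto
    show "tree_below m N ?v \<subseteq> tree_below m N u"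
    proof (rule tree_below_subset_if_incomparable[OF _ vals pos'])
      show "inv ?v a < inv ?v b \<longleftrightarrow> inv u a < inv u b" if "{a, b} \<noteq> {u i, u (i + 1)}" for a b
        using agree[OF that] by (rule sym)
    qed
  qed
qed

text \<open>A discrete intermediate value argument.\<close>

lemma adjacent_crossing:
  fixes u :: "nat \<Rightarrow> 'a"
  assumes "i < j" "P (u i)" "\<not> P (u j)"
  obtains t where "i \<le> t" "t < j" "P (u t)" "\<not> P (u (t + 1))"
proof -
  define t where "t = (LEAST t. i < t \<and> \<not> P (u t))"
  have t: "i < t" "\<not> P (u t)"
    using LeastI[of "\<lambda>t. i < t \<and> \<not> P (u t)" j] assms by (auto simp: t_def)
  have "t \<le> j"
    unfolding t_def by (rule Least_le) (use assms in auto)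
  have "P (u (t - 1))"
  proof (cases "t - 1 = i")
    case False
    then have "i < t - 1" "t - 1 < t"
      using t by auto
    then show ?thesis
      using not_less_Least[of "t - 1" "\<lambda>t. i < t \<and> \<not> P (u t)"] by (auto simp: t_def)
  qed (use assms in simp)
  then show thesis
    using that[of "t - 1"] t \<open>t \<le> j\<close> by auto
qed

text \<open>Between the letters "1" and "3" of a pattern there are neighbours that cross the value of "2";
exchanging them keeps the tree.\<close>

lemma not_avoids_132_swap:
  assumes u: "u permutes {1..N}" and "\<not> avoids_132 m N u"
  obtains i where "i \<in> {1..<N}" "u i < u (i + 1)"
    "tree_below m N (u \<circ> adj_transp i) = tree_below m N u"
proof -
  from assms(2) obtain i j k where ijk: "1 \<le> i" "i < j" "j < k" "k \<le> N" "m \<le> u k" "u i < u k" "u k < u j"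
    by (auto simp: avoids_132_def)
  obtain t where t: "i \<le> t" "t < j" "u t < u k" "\<not> u (t + 1) < u k"
    using adjacent_crossing[of i j "\<lambda>y. y < u k" u] ijk by auto
  have "u k \<noteq> u (t + 1)"
    using permutes_pos(5)[OF u, of k "t + 1"] t ijk by auto
  then have "u k < u (t + 1)"
    using t by auto
  then show thesis
    using that[of t] tree_below_swap[OF u, of t k m] t ijk by auto
qed

lemma not_avoids_312_swap:
  assumes u: "u permutes {1..N}" and "\<not> avoids_312 m N u"
  obtains i where "i \<in> {1..<N}" "u (i + 1) < u i"
    "tree_below m N (u \<circ> adj_transp i) = tree_below m N u"
proof -
  from assms(2) obtain i j k where ijk: "1 \<le> i" "i < j" "j < k" "k \<le> N" "m \<le> u k" "u j < u k" "u k < u i"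
    by (auto simp: avoids_312_def)
  obtain t where t: "i \<le> t" "t < j" "u k < u t" "\<not> u k < u (t + 1)"
    using adjacent_crossing[of i j "\<lambda>y. u k < y" u] ijk by auto
  have "u k \<noteq> u (t + 1)"
    using permutes_pos(5)[OF u, of k "t + 1"] t ijk by auto
  then have less: "u (t + 1) < u k"
    using t by auto
  have t_N: "t \<in> {1..<N}"
    using t ijk by auto
  let ?v = "u \<circ> adj_transp t"
  have vals: "?v t = u (t + 1)" "?v (t + 1) = u t" "?v k = u k"
    using t ijk by (auto simp: adj_transp_def)
  have "?v \<circ> adj_transp t = u"
    by (simp add: comp_assoc adj_transp_def)
  moreover have "tree_below m N (?v \<circ> adj_transp t) = tree_below m N ?v"
    by (rule tree_below_swap[OF permutes_compose[OF adj_transp_permutes[OF t_N] u], of t k])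
      (use t ijk less vals in auto)
  ultimately show thesis
    using that[of t] t_N less t by auto
qed

text \<open>A permutation without the pattern inverts every pair that the tree does not force to stay in
order. Since the right-hand side depends on the tree only, each class has at most one such member,
and it lies above all others.\<close>

lemma invs_avoids_132:
  assumes u: "u permutes {1..N}" and av: "avoids_132 m N u"
  shows "invs N u = {(x, z). 1 \<le> x \<and> x < z \<and> z \<le> N \<and> (x, z) \<notin> tree_below m N u}"
proof -
  have "(x, z) \<in> tree_below m N u" if xz: "1 \<le> x" "x < z" "z \<le> N" and "(x, z) \<notin> invs N u" for x z
  proof -
    have pos: "inv u x < inv u z"
      using that permutes_pos(4)[OF u, of x z] by (auto simp: invs_def)
    have "inv u y < inv u z" if y: "m \<le> y" "x < y" "y < z" for y
    proof (rule ccontr)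
      assume "\<not> inv u y < inv u z"
      moreover have "inv u y \<noteq> inv u z"
        using y permutes_pos(4)[OF u, of y z] by simp
      moreover have "inv u x \<in> {1..N}" "inv u y \<in> {1..N}"
        using xz y by (simp_all only: permutes_pos(7)[OF u]) auto
      ultimately show False
        using av[unfolded avoids_132_def, rule_format, of "inv u x" "inv u z" "inv u y"] pos y
        by (simp add: permutes_pos(2)[OF u])
    qed
    then show ?thesis
      using pos xz by (auto simp: tree_below_def)
  qed
  then show ?thesis
    using tree_below_imp_invs(1)[OF u] by (auto simp: invs_def)
qed

text \<open>Dually, a permutation without the pattern 312 inverts only those pairs that the tree forces.\<close>

lemma invs_avoids_312:
  assumes u: "u permutes {1..N}" and av: "avoids_312 m N u"
  shows "invs N u = {(x, z). 1 \<le> x \<and> x < z \<and> z \<le> N \<and> (z, x) \<in> tree_below m N u}"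
proof -
  have "(z, x) \<in> tree_below m N u" if xz: "(x, z) \<in> invs N u" for x z
  proof -
    have pos: "inv u z < inv u x" "1 \<le> x" "x < z" "z \<le> N"
      using that by (auto simp: invs_def)
    have "inv u y < inv u x" if y: "m \<le> y" "x < y" "y < z" for y
    proof (rule ccontr)
      assume "\<not> inv u y < inv u x"
      moreover have "inv u y \<noteq> inv u x"
        using y permutes_pos(4)[OF u, of y x] by simp
      moreover have "inv u z \<in> {1..N}" "inv u y \<in> {1..N}"
        using pos y by (simp_all only: permutes_pos(7)[OF u]) auto
      ultimately show False
        using av[unfolded avoids_312_def, rule_format, of "inv u z" "inv u x" "inv u y"] pos y
        by (simp add: permutes_pos(2)[OF u])
    qed
    then show ?thesis
      using pos by (auto simp: tree_below_def)
  qed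
  then show ?thesis
    using tree_below_imp_invs(2)[OF u] by (auto simp: invs_def)
qed

context
  fixes m n N :: nat
  assumes m: "1 \<le> m" and N: "N = m + n"
begin

lemma tree_equiv_iff_tree_below:
  "(u, v) \<in> tree_equiv N (lollipop m n) \<longleftrightarrow>
    u permutes {1..N} \<and> v permutes {1..N} \<and> tree_below m N u = tree_below m N v"
  using tree_equiv_iff[OF m] N by simp

lemma tree_class_memberD:
  assumes "C \<in> tree_classes N (lollipop m n)" "u \<in> C"
  shows "u permutes {1..N}"
    "v \<in> C \<longleftrightarrow> v permutes {1..N} \<and> tree_below m N v = tree_below m N u"
  using assms by (auto simp: tree_classes_def quotient_def tree_equiv_iff_tree_below)

lemma tree_class_nonempty:
  assumes "C \<in> tree_classes N (lollipop m n)"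
  obtains u where "u \<in> C"
  using assms by (auto simp: tree_classes_def quotient_def tree_equiv_iff_tree_below)

lemma card_invs_le: "card (invs N u) \<le> card ({1..N} \<times> {1..N})"
  by (rule card_mono) (auto simp: invs_def)

text \<open>A member with the largest number of inversions avoids the pattern, since a tree preserving swap
would create a further inversion.\<close>

lemma ex_avoids_132:
  assumes C: "C \<in> tree_classes N (lollipop m n)"
  obtains u where "u \<in> C" "avoids_132 m N u"
proof -
  obtain u0 where "u0 \<in> C"
    by (rule tree_class_nonempty[OF C])
  then obtain u where u: "u \<in> C" and most: "\<And>v. v \<in> C \<Longrightarrow> card (invs N v) \<le> card (invs N u)"
    using ex_has_greatest_nat[of "\<lambda>u. u \<in> C" u0 "\<lambda>u. card (invs N u)"] card_invs_le
    by (metis le_imp_less_Suc)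
  note u_perm = tree_class_memberD(1)[OF C u]
  have "avoids_132 m N u"
  proof (rule ccontr)
    assume "\<not> avoids_132 m N u"
    then obtain i where i: "i \<in> {1..<N}" "u i < u (i + 1)"
        "tree_below m N (u \<circ> adj_transp i) = tree_below m N u"
      by (rule not_avoids_132_swap[OF u_perm])
    then have "u \<circ> adj_transp i \<in> C"
      using tree_class_memberD(2)[OF C u] permutes_compose[OF adj_transp_permutes u_perm] by blast
    moreover have "(u i, u (i + 1)) \<notin> invs N u"
      using invs_positions[OF u_perm, of i "i + 1"] i(1) by auto
    ultimately show False
      using most[of "u \<circ> adj_transp i"] invs_comp_adj_transp[OF u_perm i(1,2)] finite_invs[of N u]
      by simp
  qed
  with u that show thesis
    by blast
qed

lemma ex_avoids_312:
  assumes C: "C \<in> tree_classes N (lollipop m n)"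
  obtains u where "u \<in> C" "avoids_312 m N u"
proof -
  obtain u0 where "u0 \<in> C"
    by (rule tree_class_nonempty[OF C])
  then obtain u where u: "u \<in> C" and least: "\<And>v. v \<in> C \<Longrightarrow> card (invs N u) \<le> card (invs N v)"
    using ex_has_least_nat[of "\<lambda>u. u \<in> C" u0 "\<lambda>u. card (invs N u)"] by metis
  note u_perm = tree_class_memberD(1)[OF C u]
  have "avoids_312 m N u"
  proof (rule ccontr)
    assume "\<not> avoids_312 m N u"
    then obtain i where i: "i \<in> {1..<N}" "u (i + 1) < u i"
        "tree_below m N (u \<circ> adj_transp i) = tree_below m N u"
      by (rule not_avoids_312_swap[OF u_perm])
    let ?v = "u \<circ> adj_transp i"
    have v: "?v permutes {1..N}"
      by (rule permutes_compose[OF adj_transp_permutes[OF i(1)] u_perm])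
    then have "?v \<in> C"
      using tree_class_memberD(2)[OF C u] i by blast
    have "?v \<circ> adj_transp i = u"
      by (simp add: comp_assoc adj_transp_def)
    moreover have "?v i < ?v (i + 1)"
      using i by (simp add: adj_transp_def)
    ultimately have "invs N u = insert (?v i, ?v (i + 1)) (invs N ?v)"
      using invs_comp_adj_transp[OF v i(1)] by simp
    moreover have "(?v i, ?v (i + 1)) \<notin> invs N ?v"
      using invs_positions[OF v, of i "i + 1"] i(1) by auto
    ultimately show False
      using least[OF \<open>?v \<in> C\<close>] finite_invs[of N ?v] by simp
  qed
  with u that show thesis
    by blast
qed

lemma class_max_eqI:
  assumes C: "C \<in> tree_classes N (lollipop m n)" and u: "u \<in> C" "avoids_132 m N u"
  shows "class_max N C = u"
  unfolding class_max_def
proof (rule the_equality)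
  note u_perm = tree_class_memberD(1)[OF C u(1)]
  have above: "invs N v \<subseteq> invs N u" if "v \<in> C" for v
  proof -
    have "v permutes {1..N}" "tree_below m N v = tree_below m N u"
      using tree_class_memberD(2)[OF C u(1)] that by auto
    then show ?thesis
      using invs_avoids_132[OF u_perm u(2)] tree_below_imp_invs(1)[of v N _ _ m]
      by (fastforce simp: invs_def)
  qed
  show "u \<in> C \<and> (\<forall>v\<in>C. weak_le N u v \<longrightarrow> v = u)"
    using u(1) above invs_inject[OF _ u_perm] weak_le_imp_invs_subset tree_class_memberD(1)[OF C]
    by (meson subset_antisym)
  fix w assume w: "w \<in> C \<and> (\<forall>v\<in>C. weak_le N w v \<longrightarrow> v = w)"
  then show "w = u"
    using invs_subset_imp_weak_le[OF _ u_perm above] tree_class_memberD(1)[OF C] u(1) by metis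
qed

lemma class_min_eqI:
  assumes C: "C \<in> tree_classes N (lollipop m n)" and u: "u \<in> C" "avoids_312 m N u"
  shows "class_min N C = u"
  unfolding class_min_def
proof (rule the_equality)
  note u_perm = tree_class_memberD(1)[OF C u(1)]
  have "invs N u \<subseteq> invs N v" if "v \<in> C" for v
  proof -
    have "v permutes {1..N}" "tree_below m N v = tree_below m N u"
      using tree_class_memberD(2)[OF C u(1)] that by auto
    then show ?thesis
      using invs_avoids_312[OF u_perm u(2)] tree_below_imp_invs(2)[of v N _ _ m] by auto
  qed
  then have below: "invs N u \<subseteq> invs N v" if "v \<in> C" for v
    using that .
  show "u \<in> C \<and> (\<forall>v\<in>C. weak_le N v u \<longrightarrow> v = u)"
    using u(1) below invs_inject[OF _ u_perm] weak_le_imp_invs_subset tree_class_memberD(1)[OF C]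
    by (meson subset_antisym)
  fix w assume w: "w \<in> C \<and> (\<forall>v\<in>C. weak_le N v w \<longrightarrow> v = w)"
  then show "w = u"
    using invs_subset_imp_weak_le[OF u_perm _ below] tree_class_memberD(1)[OF C] u(1) by metis
qed

lemma class_max:
  assumes C: "C \<in> tree_classes N (lollipop m n)"
  shows "class_max N C \<in> C" "class_max N C permutes {1..N}" "avoids_132 m N (class_max N C)"
  using ex_avoids_132[OF C] class_max_eqI[OF C] tree_class_memberD(1)[OF C] by metis+

lemma class_min:
  assumes C: "C \<in> tree_classes N (lollipop m n)"
  shows "class_min N C \<in> C" "class_min N C permutes {1..N}" "avoids_312 m N (class_min N C)"
  using ex_avoids_312[OF C] class_min_eqI[OF C] tree_class_memberD(1)[OF C] by metis+

lemma class_max_inject: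
  assumes "C \<in> tree_classes N (lollipop m n)" "D \<in> tree_classes N (lollipop m n)"
    "class_max N C = class_max N D"
  shows "C = D"
  using tree_class_memberD(2)[OF assms(1) class_max(1)[OF assms(1)]]
    tree_class_memberD(2)[OF assms(2) class_max(1)[OF assms(2)]] assms(3) by auto

text \<open>Every permutation that avoids the pattern is the maximum of its class. So the classes are in
bijection with these permutations.\<close>

lemma ex_class_with_max:
  assumes "u permutes {1..N}" "avoids_132 m N u"
  obtains C where "C \<in> tree_classes N (lollipop m n)" "class_max N C = u"
proof -
  let ?C = "tree_equiv N (lollipop m n) `` {u}"
  have "?C \<in> tree_classes N (lollipop m n)"
    using assms(1) by (auto simp: tree_classes_def quotient_def)
  moreover have "u \<in> ?C"
    using assms(1) by (simp add: tree_equiv_iff_tree_below)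
  ultimately show thesis
    using that class_max_eqI assms(2) by blast
qed

text \<open>The order on classes is defined by comparing minima; it is the same to compare maxima. Both
directions pass between the two extreme members by the descriptions of their inversions in terms
of the common tree.\<close>

lemma tub_le_iff:
  assumes C: "C \<in> tree_classes N (lollipop m n)" and D: "D \<in> tree_classes N (lollipop m n)"
  shows "tub_le N C D \<longleftrightarrow> invs N (class_max N C) \<subseteq> invs N (class_max N D)"
proof -
  let ?u = "class_max N C" and ?u' = "class_min N C" and ?v = "class_max N D" and ?v' = "class_min N D"
  note u = class_max[OF C] and u' = class_min[OF C] and v = class_max[OF D] and v' = class_min[OF D]
  have below_C: "tree_below m N ?u' = tree_below m N ?u"
    and below_D: "tree_below m N ?v' = tree_below m N ?v"
    using tree_class_memberD(2)[OF C u(1)] u'(1) tree_class_memberD(2)[OF D v(1)] v'(1) by auto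
  note invs_u = invs_avoids_132[OF u(2,3)] and invs_v = invs_avoids_132[OF v(2,3)]
  note invs_u' = invs_avoids_312[OF u'(2,3), unfolded below_C]
    and invs_v' = invs_avoids_312[OF v'(2,3), unfolded below_D]
  have "tub_le N C D \<longleftrightarrow> invs N ?u' \<subseteq> invs N ?v'"
    unfolding tub_le_def by (rule weak_le_iff_invs_subset[OF u'(2) v'(2)])
  also have "\<dots> \<longleftrightarrow> invs N ?u \<subseteq> invs N ?v"
  proof
    assume sub: "invs N ?u' \<subseteq> invs N ?v'"
    show "invs N ?u \<subseteq> invs N ?v"
    proof (rule ccontr)
      assume "\<not> ?thesis"
      then obtain x z where xz: "(x, z) \<in> invs N ?u" "(x, z) \<notin> invs N ?v"
        by auto
      then have xz_N: "1 \<le> x" "x < z" "z \<le> N" and D_xz: "(x, z) \<in> tree_below m N ?v"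
        and C_xz: "(x, z) \<notin> tree_below m N ?u"
        unfolding invs_u invs_v by auto
      have "(x, z) \<notin> invs N ?v'"
        using tree_below_imp_invs(1)[OF v'(2) xz_N(2), of m] D_xz below_D by simp
      then have "(x, z) \<notin> invs N ?u'"
        using sub by auto
      then have "inv ?u' x < inv ?u' z"
        using xz_N permutes_pos(4)[OF u'(2), of x z] by (auto simp: invs_def)
      moreover have "(x, z) \<notin> tree_below m N ?u'"
        using C_xz below_C by simp
      ultimately obtain y0 where y0: "m \<le> y0" "x < y0" "y0 < z" "inv ?u' z \<le> inv ?u' y0"
        using xz_N by (auto simp: tree_below_def)
      \<comment> \<open>Of all separators of \<open>x\<close> and \<open>z\<close>, the last one in the word is an ancestor of \<open>z\<close> in \<open>C\<close>,
        so it is inverted with \<open>z\<close>; but in \<open>D\<close> every separator of \<open>x\<close> and \<open>z\<close> precedes \<open>z\<close>.\<close>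
      let ?sep = "\<lambda>y. m \<le> y \<and> x < y \<and> y < z"
      have "inv ?u' w \<le> N" if "?sep w" for w
        using permutes_pos(7)[OF u'(2), of w] xz_N that by simp
      then have "\<exists>y. ?sep y \<and> (\<forall>w. ?sep w \<longrightarrow> inv ?u' w \<le> inv ?u' y)"
        using y0 by (intro ex_has_greatest_nat[of ?sep y0 "inv ?u'" "Suc N"])
            (auto simp: less_Suc_eq_le)
      then obtain y where y: "?sep y" and last: "\<And>w. ?sep w \<Longrightarrow> inv ?u' w \<le> inv ?u' y"
        by blast
      have z_y: "inv ?u' z \<le> inv ?u' y"
        using last[of y0] y0 by simp
      have "(z, y) \<in> tree_below m N ?u'"
      proof -
        have "inv ?u' w < inv ?u' y" if "m \<le> w" "y < w" "w < z" for w
          using last[of w] permutes_pos(4)[OF u'(2), of w y] that y by (simp add: order_le_less)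
        then show ?thesis
          using z_y y xz_N by (auto simp: tree_below_def)
      qed
      then have "(y, z) \<in> invs N ?u'"
        using tree_below_imp_invs(2)[OF u'(2)] y by blast
      then have "(y, z) \<in> invs N ?v'"
        using sub by auto
      then have "inv ?v' z < inv ?v' y"
        by (simp add: invs_def)
      moreover have "(x, z) \<in> tree_below m N ?v'"
        using D_xz below_D by simp
      then have "inv ?v' y < inv ?v' z"
        using y by (auto simp: tree_below_def)
      ultimately show False
        by simp
    qed
  next
    assume sub: "invs N ?u \<subseteq> invs N ?v"
    show "invs N ?u' \<subseteq> invs N ?v'"
    proof clarify
      fix x z assume "(x, z) \<in> invs N ?u'"
      then have xz_N: "1 \<le> x" "x < z" "z \<le> N" and C_zx: "(z, x) \<in> tree_below m N ?u"
        unfolding invs_u' by auto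
      have "(x, z) \<in> invs N ?v"
        using tree_below_imp_invs(2)[OF u(2) xz_N(2)] C_zx sub by blast
      then have v_zx: "inv ?v z < inv ?v x"
        by (simp add: invs_def)
      have "inv ?v y < inv ?v x" if y: "m \<le> y" "x < y" "y < z" for y
      proof (rule ccontr)
        assume "\<not> inv ?v y < inv ?v x"
        then have "(x, y) \<notin> invs N ?v"
          by (simp add: invs_def)
        then have "(x, y) \<notin> invs N ?u"
          using sub by auto
        moreover have "inv ?u y < inv ?u x"
          using C_zx y by (auto simp: tree_below_def)
        ultimately show False
          using y xz_N by (simp add: invs_def)
      qed
      then have "(z, x) \<in> tree_below m N ?v"
        using v_zx xz_N by (auto simp: tree_below_def)
      then show "(x, z) \<in> invs N ?v'"
        unfolding invs_v' using xz_N by simp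
    qed
  qed
  finally show ?thesis .
qed

end

section \<open>Covers of the tubing lattice are jumps\<close>

text \<open>In terms of inversions, avoidance is a closure property of the set of values that \<open>z\<close> precedes.\<close>

lemma avoids_132_iff_invs:
  assumes u: "u permutes {1..N}"
  shows "avoids_132 m N u \<longleftrightarrow>
    (\<forall>x y z. 1 \<le> x \<and> x < y \<and> m \<le> y \<and> (y, z) \<in> invs N u \<longrightarrow> (x, z) \<in> invs N u)"
proof
  assume av: "avoids_132 m N u"
  show "\<forall>x y z. 1 \<le> x \<and> x < y \<and> m \<le> y \<and> (y, z) \<in> invs N u \<longrightarrow> (x, z) \<in> invs N u"
  proof (intro allI impI)
    fix x y z assume xyz: "1 \<le> x \<and> x < y \<and> m \<le> y \<and> (y, z) \<in> invs N u"
    then have yz: "y < z" "z \<le> N" "inv u z < inv u y"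
      by (auto simp: invs_def)
    have pos: "inv u x \<in> {1..N}" "inv u y \<in> {1..N}"
      using xyz yz by (simp_all only: permutes_pos(7)[OF u]) auto
    have "\<not> inv u x < inv u z"
      using av[unfolded avoids_132_def, rule_format, of "inv u x" "inv u z" "inv u y"] pos xyz yz
      by (auto simp: permutes_pos(2)[OF u])
    then show "(x, z) \<in> invs N u"
      using xyz yz permutes_pos(4)[OF u, of x z] by (simp add: invs_def)
  qed
next
  assume closed: "\<forall>x y z. 1 \<le> x \<and> x < y \<and> m \<le> y \<and> (y, z) \<in> invs N u \<longrightarrow> (x, z) \<in> invs N u"
  show "avoids_132 m N u"
    unfolding avoids_132_def
  proof (intro allI impI notI)
    fix i j k
    assume ijk: "1 \<le> i \<and> i < j \<and> j < k \<and> k \<le> N \<and> m \<le> u k" and vals: "u i < u k \<and> u k < u j"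
    have "(u k, u j) \<in> invs N u"
      using invs_positions[OF u, of k j] ijk vals by auto
    moreover have "u i \<in> {1..N}"
      using ijk by (simp only: permutes_pos(6)[OF u]) auto
    ultimately have "(u i, u j) \<in> invs N u"
      using closed ijk vals by auto
    then show False
      using invs_positions[OF u, of i j] ijk by auto
  qed
qed

text \<open>The value \<open>u b\<close> is to move to position \<open>a\<close>. If its left neighbour \<open>u (b - 1)\<close> is at least \<open>m\<close>, then
having passed it the value must also pass all smaller entries next to it, up to the first entry
larger than this neighbour.\<close>

definition jump :: "nat \<Rightarrow> nat \<Rightarrow> (nat \<Rightarrow> nat) \<Rightarrow> nat \<Rightarrow> nat \<Rightarrow> bool" where
  "jump m N u a b \<longleftrightarrow> 1 \<le> a \<and> a < b \<and> b \<le> N \<and> u (b - 1) < u b \<and>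
    (\<forall>i. a \<le> i \<and> i < b \<longrightarrow> u i \<le> u (b - 1)) \<and>
    (if u (b - 1) < m then a = b - 1 else a = 1 \<or> u (b - 1) < u (a - 1))"

lemma jump_permutes:
  "u permutes {1..N} \<Longrightarrow> jump m N u a b \<Longrightarrow> (u \<circ> adj_cycle a b) permutes {1..N}"
  by (rule permutes_compose[OF adj_cycle_permutes]) (auto simp: jump_def)

lemma invs_jump:
  assumes "u permutes {1..N}" "jump m N u a b"
  shows "invs N (u \<circ> adj_cycle a b) = invs N u \<union> {(u i, u b) | i. a \<le> i \<and> i < b}"
proof (rule invs_comp_adj_cycle[OF assms(1)])
  show "u i < u b" if "a \<le> i" "i < b" for i
    using that assms(2) unfolding jump_def by (meson le_less_trans)
qed (use assms(2) in \<open>auto simp: jump_def\<close>)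

lemma ascent_not_in_invs:
  assumes "u permutes {1..N}" "i \<in> {1..<N}"
  shows "(u i, u (i + 1)) \<notin> invs N u"
  using invs_positions[OF assms(1), of i "i + 1"] assms(2) by auto

lemma jump_new_inversion:
  assumes "u permutes {1..N}" "jump m N u a b"
  shows "(u (b - 1), u b) \<in> invs N (u \<circ> adj_cycle a b)" "(u (b - 1), u b) \<notin> invs N u"
proof -
  have b: "1 \<le> a" "a < b" "b \<le> N"
    using assms(2) by (auto simp: jump_def)
  then have "b - 1 \<in> {1..<N}" "b - 1 + 1 = b"
    by auto
  then show "(u (b - 1), u b) \<notin> invs N u"
    using ascent_not_in_invs[OF assms(1), of "b - 1"] by metis
  have "a \<le> b - 1" "b - 1 < b"
    using b by auto
  then show "(u (b - 1), u b) \<in> invs N (u \<circ> adj_cycle a b)"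
    unfolding invs_jump[OF assms] by blast
qed

lemma jump_avoids_132:
  assumes u: "u permutes {1..N}" and av: "avoids_132 m N u" and jump: "jump m N u a b"
  shows "avoids_132 m N (u \<circ> adj_cycle a b)"
  unfolding avoids_132_iff_invs[OF jump_permutes[OF u jump]]
proof (intro allI impI)
  fix x y z
  assume xyz: "1 \<le> x \<and> x < y \<and> m \<le> y \<and> (y, z) \<in> invs N (u \<circ> adj_cycle a b)"
  note closed = av[unfolded avoids_132_iff_invs[OF u], rule_format]
  note new = invs_jump[OF u jump]
  have ab: "1 \<le> a" "a < b" "b \<le> N" and run: "\<And>i. a \<le> i \<Longrightarrow> i < b \<Longrightarrow> u i \<le> u (b - 1)"
    using jump by (auto simp: jump_def)
  show "(x, z) \<in> invs N (u \<circ> adj_cycle a b)"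
  proof (cases "(y, z) \<in> invs N u")
    case True
    then show ?thesis
      using closed[of x y z] xyz new by auto
  next
    case False
    then obtain i where i: "y = u i" "z = u b" "a \<le> i" "i < b"
      using xyz new by auto
    have y_le: "y \<le> u (b - 1)"
      using run i by simp
    define j where "j = inv u x"
    have x: "x = u j"
      by (simp add: j_def permutes_pos(2)[OF u])
    have z_N: "u b \<in> {1..N}"
      using ab by (simp only: permutes_pos(6)[OF u]) auto
    have "u i < u b"
      using jump i run[of i] unfolding jump_def by linarith
    then have "x < z" "x \<in> {1..N}"
      using xyz i z_N by auto
    then have j_N: "j \<in> {1..N}"
      unfolding x permutes_pos(6)[OF u] by blast
    consider "b < j" | "a \<le> j" "j < b" | "j < a"
      using \<open>x < z\<close> x i by (metis less_irrefl linorder_neqE_nat not_le)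
    then show ?thesis
    proof cases
      case 1
      then have "(x, z) \<in> invs N u"
        using invs_positions[OF u, of j b] j_N ab \<open>x < z\<close> x i(2) by auto
      then show ?thesis
        using new by auto
    next
      case 2
      then show ?thesis
        using new x i(2) by auto
    next
      \<comment> \<open>The entry that stopped the run would be the middle letter of a forbidden pattern in \<open>u\<close>.\<close>
      case 3
      let ?t = "u (a - 1)"
      have "m \<le> u (b - 1)"
        using xyz y_le by simp
      then have t: "u (b - 1) < ?t"
        using jump 3 j_N by (auto simp: jump_def)
      have pos: "b - 1 \<in> {1..N}" "a - 1 \<in> {1..N}" "a - 1 < b - 1"
        using ab 3 j_N by auto
      with t have "(u (b - 1), ?t) \<in> invs N u"
        using invs_positions[OF u] by blast
      then have "(x, ?t) \<in> invs N u"
        using closed[of x "u (b - 1)" ?t] xyz y_le \<open>m \<le> u (b - 1)\<close> by auto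
      then show ?thesis
        using invs_positions[OF u j_N pos(2)] 3 x by force
    qed
  qed
qed

text \<open>If \<open>v\<close> avoids the pattern and inverts \<open>u (b - 1)\<close> with \<open>u b\<close>, the closure property makes it invert the
rest of the run with \<open>u b\<close>, too.\<close>

lemma jump_least:
  assumes u: "u permutes {1..N}" and v: "v permutes {1..N}" "avoids_132 m N v"
    and sub: "invs N u \<subseteq> invs N v" and jump: "jump m N u a b" and inverted: "(u (b - 1), u b) \<in> invs N v"
  shows "invs N (u \<circ> adj_cycle a b) \<subseteq> invs N v"
proof -
  have "(u i, u b) \<in> invs N v" if i: "a \<le> i" "i < b" for i
  proof (cases "i = b - 1")
    case True
    then show ?thesis using inverted by simp
  next
    case False
    have "u i \<le> u (b - 1)"
      using jump i by (auto simp: jump_def)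
    moreover have "u i \<noteq> u (b - 1)"
      using False permutes_pos(5)[OF u, of i "b - 1"] by simp
    moreover have "m \<le> u (b - 1)"
      using jump i False by (auto simp: jump_def split: if_splits)
    moreover have "u i \<in> {1..N}"
      using i jump by (simp only: permutes_pos(6)[OF u]) (auto simp: jump_def)
    ultimately show ?thesis
      using v(2)[unfolded avoids_132_iff_invs[OF v(1)], rule_format, of "u i" "u (b - 1)" "u b"] inverted
      by simp
  qed
  then show ?thesis
    using sub invs_jump[OF u jump] by auto
qed

lemma ex_jump:
  assumes i: "i \<in> {1..<N}" "u i < u (i + 1)"
  obtains a where "jump m N u a (i + 1)"
proof (cases "u i < m")
  case True
  have "j = i" if "i \<le> j" "j < i + 1" for j
    using that by simp
  then have "u j \<le> u i" if "i \<le> j \<and> j < i + 1" for j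
    using that by (metis order_refl)
  then have "jump m N u i (i + 1)"
    using i True by (simp add: jump_def)
  then show thesis
    by (rule that)
next
  case False
  let ?run = "\<lambda>a. 1 \<le> a \<and> a \<le> i \<and> (\<forall>j. a \<le> j \<and> j \<le> i \<longrightarrow> u j \<le> u i)"
  define a where "a = (LEAST a. ?run a)"
  have "?run i"
    using i by auto
  then have a: "?run a"
    unfolding a_def by (rule LeastI)
  have "u i < u (a - 1)" if "a \<noteq> 1"
  proof (rule ccontr)
    assume "\<not> u i < u (a - 1)"
    have "u j \<le> u i" if "a - 1 \<le> j" "j \<le> i" for j
      using that a \<open>\<not> u i < u (a - 1)\<close> by (cases "j = a - 1") auto
    then have "?run (a - 1)"
      using a \<open>a \<noteq> 1\<close> by auto
    then have "(LEAST a. ?run a) \<le> a - 1"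
      by (rule Least_le)
    then have "a \<le> a - 1"
      unfolding a_def[symmetric] .
    moreover have "1 \<le> a"
      using a by blast
    ultimately show False
      by linarith
  qed
  then have "jump m N u a (i + 1)"
    using i False a by (auto simp: jump_def)
  then show thesis
    by (rule that)
qed

section \<open>Maximal chains are climbs\<close>

text \<open>The permutations reached are the maxima of the classes on a saturated chain from the bottom, and the
list records the cycles by which consecutive ones differ.\<close>

inductive climb :: "nat \<Rightarrow> nat \<Rightarrow> (nat \<Rightarrow> nat) list \<Rightarrow> (nat \<Rightarrow> nat) \<Rightarrow> bool" for m N where
  climb_Nil: "climb m N [] id"
| climb_snoc: "climb m N \<gamma> u \<Longrightarrow> jump m N u a b \<Longrightarrow>
    climb m N (\<gamma> @ [adj_cycle a b]) (u \<circ> adj_cycle a b)"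

definition rev_perm :: "nat \<Rightarrow> nat \<Rightarrow> nat" where
  "rev_perm N i = (if 1 \<le> i \<and> i \<le> N then N + 1 - i else i)"

lemma rev_perm_rev_perm: "rev_perm N (rev_perm N i) = i"
  by (auto simp: rev_perm_def)

lemma rev_perm_permutes: "rev_perm N permutes {1..N}"
  by (rule bij_imp_permutes, rule bij_betwI[where g = "rev_perm N"])
    (auto simp: rev_perm_rev_perm, auto simp: rev_perm_def)

lemma inv_rev_perm: "inv (rev_perm N) = rev_perm N"
  by (rule inv_unique_comp) (auto simp: rev_perm_rev_perm fun_eq_iff)

lemma invs_rev_perm: "invs N (rev_perm N) = {(x, z). 1 \<le> x \<and> x < z \<and> z \<le> N}"
  by (auto simp: invs_def inv_rev_perm rev_perm_def)

lemma invs_id: "invs N id = {}"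
  by (auto simp: invs_def)

lemma avoids_132_id: "avoids_132 m N id"
  by (auto simp: avoids_132_def)

lemma avoids_132_rev_perm: "avoids_132 m N (rev_perm N)"
  by (auto simp: avoids_132_def rev_perm_def)

lemma climb_imp_avoids_132:
  assumes "climb m N \<gamma> u"
  shows "u permutes {1..N} \<and> avoids_132 m N u"
  using assms
proof induction
  case climb_Nil
  show ?case
    using permutes_id avoids_132_id by blast
next
  case climb_snoc
  then show ?case
    using jump_permutes jump_avoids_132 by blast
qed

context
  fixes m n N :: nat
  assumes m: "1 \<le> m" and N: "N = m + n"
begin

abbreviation "classes \<equiv> tree_classes N (lollipop m n)"
abbreviation "covers \<equiv> tub_cover N (lollipop m n)"
abbreviation "maxchains \<equiv> tub_maxchains N (lollipop m n)"

text \<open>Any larger class inverts an ascent of the given maximum, and by \<open>jump_least\<close> it lies above the jump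
at this ascent. Conversely a jump inverts a single ascent, so nothing fits strictly below it.\<close>

lemma tub_cover_iff_jump:
  "covers C D \<longleftrightarrow> C \<in> classes \<and> D \<in> classes \<and>
    (\<exists>a b. jump m N (class_max N C) a b \<and> class_max N D = class_max N C \<circ> adj_cycle a b)"
proof (cases "C \<in> classes \<and> D \<in> classes")
  case True
  then have C: "C \<in> classes" and D: "D \<in> classes"
    by auto
  note le_iff = tub_le_iff[OF m N]
  let ?u = "class_max N C" and ?v = "class_max N D"
  note u = class_max[OF m N C] and v = class_max[OF m N D]
  show ?thesis
  proof
    assume cover: "covers C D"
    then have "?u \<noteq> ?v" "invs N ?u \<subseteq> invs N ?v"
      using class_max_inject[OF m N C D] le_iff[OF C D] by (auto simp: tub_cover_def)
    then obtain i where i: "i \<in> {1..<N}" "?u i < ?u (i + 1)" "(?u i, ?u (i + 1)) \<in> invs N ?v"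
      using invs_subset_ascent[OF u(2) v(2)] by blast
    obtain a where jump: "jump m N ?u a (i + 1)"
      by (rule ex_jump[OF i(1,2)])
    let ?w = "?u \<circ> adj_cycle a (i + 1)"
    obtain X where X: "X \<in> classes" "class_max N X = ?w"
      using ex_class_with_max[OF m N jump_permutes[OF u(2) jump] jump_avoids_132[OF u(2,3) jump]] .
    have "tub_le N C X"
      unfolding le_iff[OF C X(1)] X(2) invs_jump[OF u(2) jump] by blast
    moreover have "tub_le N X D"
      unfolding le_iff[OF X(1) D] X(2)
      by (rule jump_least[OF u(2) v(2,3) _ jump])
        (use i \<open>invs N ?u \<subseteq> invs N ?v\<close> in auto)
    ultimately have "X = C \<or> X = D"
      using cover X(1) by (auto simp: tub_cover_def)
    moreover have "X \<noteq> C"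
      using jump_new_inversion[OF u(2) jump] X(2) by auto
    ultimately show "C \<in> classes \<and> D \<in> classes \<and>
        (\<exists>a b. jump m N ?u a b \<and> ?v = ?u \<circ> adj_cycle a b)"
      using C D X(2) jump by auto
  next
    assume "C \<in> classes \<and> D \<in> classes \<and> (\<exists>a b. jump m N ?u a b \<and> ?v = ?u \<circ> adj_cycle a b)"
    then obtain a b where jump: "jump m N ?u a b" and v_eq: "?v = ?u \<circ> adj_cycle a b"
      by auto
    note new = jump_new_inversion[OF u(2) jump, folded v_eq]
      and invs_v = invs_jump[OF u(2) jump, folded v_eq]
    have "C \<noteq> D"
      using new by auto
    moreover have "tub_le N C D"
      unfolding le_iff[OF C D] invs_v by blast
    moreover have "X = C \<or> X = D" if X: "X \<in> classes" and CX: "tub_le N C X" and XD: "tub_le N X D" for X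
    proof (cases "X = C")
      case False
      let ?w = "class_max N X"
      note w = class_max[OF m N X]
      have uw: "invs N ?u \<subseteq> invs N ?w" and wv: "invs N ?w \<subseteq> invs N ?v"
        using CX XD le_iff[OF C X] le_iff[OF X D] by auto
      have "?u \<noteq> ?w"
        using class_max_inject[OF m N C X] False by auto
      then obtain i where i: "i \<in> {1..<N}" "?u i < ?u (i + 1)" "(?u i, ?u (i + 1)) \<in> invs N ?w"
        using invs_subset_ascent[OF u(2) w(2) uw] by blast
      then have "(?u i, ?u (i + 1)) \<in> invs N ?v - invs N ?u"
        using wv ascent_not_in_invs[OF u(2) i(1)] by auto
      then have "?u (i + 1) = ?u b"
        using invs_v by auto
      then have "b = i + 1"
        using permutes_pos(5)[OF u(2)] by metis
      then have "invs N ?v \<subseteq> invs N ?w"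
        using jump_least[OF u(2) w(2,3) uw jump] i(3) v_eq by simp
      with wv have "?w = ?v"
        using invs_inject[OF w(2) v(2)] by blast
      then show ?thesis
        using class_max_inject[OF m N X D] by simp
    qed simp
    ultimately show "covers C D"
      using C D by (auto simp: tub_cover_def)
  qed
next
  case False
  then show ?thesis
    unfolding tub_cover_def by blast
qed

lemma cover_chain_invs_mono:
  assumes "successively covers Cs" "i \<le> j" "j < length Cs"
  shows "invs N (class_max N (Cs ! i)) \<subseteq> invs N (class_max N (Cs ! j))"
  using assms(2,3)
proof (induction j rule: dec_induct)
  case base
  show ?case
    by (rule order_refl)
next
  case (step j)
  have "covers (Cs ! j) (Cs ! Suc j)"
    using assms(1) step.prems unfolding successively_conv_nth by blast
  then have C: "Cs ! j \<in> classes" "Cs ! Suc j \<in> classes" "tub_le N (Cs ! j) (Cs ! Suc j)"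
    unfolding tub_cover_def by blast+
  have "invs N (class_max N (Cs ! j)) \<subseteq> invs N (class_max N (Cs ! Suc j))"
    using C(3) unfolding tub_le_iff[OF m N C(1,2)] .
  moreover have "invs N (class_max N (Cs ! i)) \<subseteq> invs N (class_max N (Cs ! j))"
    using step.IH step.prems by linarith
  ultimately show ?case
    by (rule subset_trans[rotated])
qed

lemma maxchain_endpoints:
  assumes "Cs \<in> maxchains"
  shows "Cs \<noteq> []" "class_max N (hd Cs) = id" "class_max N (last Cs) = rev_perm N"
proof -
  have succ: "successively covers Cs"
    and chain: "pred_on.chain classes (tub_le N) (set Cs)"
    and maximal: "\<And>S. pred_on.chain classes (tub_le N) S \<Longrightarrow> \<not> set Cs \<subset> S"
    using assms by (auto simp: tub_maxchains_def pred_on.maxchain_def)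
  have set_Cs: "set Cs \<subseteq> classes"
    using chain by (auto simp: pred_on.chain_def)
  note le_iff = tub_le_iff[OF m N]
  have mem: "B \<in> set Cs" if B: "B \<in> classes" "\<And>C. C \<in> set Cs \<Longrightarrow> tub_le N B C \<or> tub_le N C B" for B
  proof -
    have "pred_on.chain classes (tub_le N) (insert B (set Cs))"
      using chain B by (auto simp: pred_on.chain_def)
    then show ?thesis
      using maximal by blast
  qed
  \<comment> \<open>The bottom and the top class are comparable to everything, so a maximal chain contains them.\<close>
  obtain B where B: "B \<in> classes" "class_max N B = id"
    using ex_class_with_max[OF m N permutes_id avoids_132_id] .
  obtain T where T: "T \<in> classes" "class_max N T = rev_perm N"
    using ex_class_with_max[OF m N rev_perm_permutes avoids_132_rev_perm] .
  have "tub_le N B C" "tub_le N C T" if "C \<in> classes" for C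
    using le_iff[OF B(1) that] le_iff[OF that T(1)] B(2) T(2)
    by (auto simp: invs_id invs_rev_perm) (auto simp: invs_def)
  then have BT: "B \<in> set Cs" "T \<in> set Cs"
    using mem[OF B(1)] mem[OF T(1)] set_Cs by auto
  then show "Cs \<noteq> []"
    by auto
  then have ends: "hd Cs = Cs ! 0" "last Cs = Cs ! (length Cs - 1)" "hd Cs \<in> classes" "last Cs \<in> classes"
    using set_Cs by (auto simp: hd_conv_nth last_conv_nth)
  obtain i j where ij: "i < length Cs" "Cs ! i = B" "j < length Cs" "Cs ! j = T"
    using BT by (meson in_set_conv_nth)
  have "invs N (class_max N (hd Cs)) \<subseteq> invs N id"
    using cover_chain_invs_mono[OF succ, of 0 i] ij ends B(2) by simp
  then show "class_max N (hd Cs) = id"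
    using invs_inject[OF class_max(2)[OF m N ends(3)] permutes_id] by (simp add: invs_id)
  have "invs N (rev_perm N) \<subseteq> invs N (class_max N (last Cs))"
    using cover_chain_invs_mono[OF succ, of j "length Cs - 1"] ij ends T(2) by fastforce
  moreover have "invs N (class_max N (last Cs)) \<subseteq> invs N (rev_perm N)"
    unfolding invs_rev_perm by (auto simp: invs_def)
  ultimately show "class_max N (last Cs) = rev_perm N"
    using invs_inject[OF class_max(2)[OF m N ends(4)] rev_perm_permutes] by blast
qed

text \<open>An element that could be added to a chain from bottom to top would lie between two consecutive
members, which is impossible as these form a cover.\<close>

lemma maxchainI:
  assumes succ: "successively covers Cs" and set_Cs: "set Cs \<subseteq> classes" and "Cs \<noteq> []"
    and hd: "class_max N (hd Cs) = id" and last: "class_max N (last Cs) = rev_perm N"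
  shows "Cs \<in> maxchains"
proof -
  note le_iff = tub_le_iff[OF m N]
  have "pred_on.chain classes (tub_le N) (set Cs)"
    unfolding pred_on.chain_def
  proof (intro conjI ballI set_Cs)
    fix C D assume CD: "C \<in> set Cs" "D \<in> set Cs"
    then obtain i j where "i < length Cs" "Cs ! i = C" "j < length Cs" "Cs ! j = D"
      by (meson in_set_conv_nth)
    then have "tub_le N C D \<or> tub_le N D C"
      using cover_chain_invs_mono[OF succ, of i j] cover_chain_invs_mono[OF succ, of j i]
        le_iff[of C D] le_iff[of D C] CD set_Cs by (meson nat_le_linear subsetD)
    then show "sup (tub_le N) (=) C D \<or> sup (tub_le N) (=) D C"
      by auto
  qed
  moreover have False if S: "pred_on.chain classes (tub_le N) S" and "set Cs \<subset> S" for S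
  proof -
    from \<open>set Cs \<subset> S\<close> obtain X where X: "X \<in> S" "X \<notin> set Cs"
      by auto
    have X_class: "X \<in> classes"
      using S X by (auto simp: pred_on.chain_def)
    have ends: "hd Cs \<in> classes" "last Cs \<in> classes"
      using \<open>Cs \<noteq> []\<close> set_Cs by auto
    have "tub_le N (hd Cs) X"
      unfolding le_iff[OF ends(1) X_class] hd invs_id by simp
    moreover have "\<not> tub_le N (last Cs) X"
    proof
      assume "tub_le N (last Cs) X"
      then have "invs N (rev_perm N) \<subseteq> invs N (class_max N X)"
        unfolding le_iff[OF ends(2) X_class] last .
      moreover have "invs N (class_max N X) \<subseteq> invs N (rev_perm N)"
        unfolding invs_rev_perm by (auto simp: invs_def)
      ultimately have "class_max N X = class_max N (last Cs)"
        using invs_inject[OF class_max(2)[OF m N X_class] rev_perm_permutes] last by simp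
      then have "X = last Cs"
        by (rule class_max_inject[OF m N X_class ends(2)])
      then show False
        using X \<open>Cs \<noteq> []\<close> by simp
    qed
    ultimately have crossing: "tub_le N (Cs ! 0) X" "\<not> tub_le N (Cs ! (length Cs - 1)) X"
      using \<open>Cs \<noteq> []\<close> by (auto simp: hd_conv_nth last_conv_nth)
    have "length Cs - 1 \<noteq> 0"
    proof
      assume "length Cs - 1 = 0"
      then show False
        using crossing by simp
    qed
    then have "0 < length Cs - 1"
      by simp
    from adjacent_crossing[of 0 "length Cs - 1" "\<lambda>C. tub_le N C X" "(!) Cs", OF this crossing]
    obtain k where k: "k < length Cs - 1" "tub_le N (Cs ! k) X" "\<not> tub_le N (Cs ! (k + 1)) X"
      by metis
    have k_mem: "Cs ! k \<in> set Cs" "Cs ! (k + 1) \<in> set Cs"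
      using k(1) by auto
    then have "tub_le N X (Cs ! (k + 1))"
      using S X k(3) \<open>set Cs \<subset> S\<close> by (auto simp: pred_on.chain_def)
    moreover have "covers (Cs ! k) (Cs ! (k + 1))"
      using succ k(1) by (simp add: successively_conv_nth)
    ultimately have "X = Cs ! k \<or> X = Cs ! (k + 1)"
      using k(2) X_class by (auto simp: tub_cover_def)
    then show False
      using X k_mem by auto
  qed
  ultimately show ?thesis
    using succ by (auto simp: tub_maxchains_def pred_on.maxchain_def)
qed

lemma maxchain_imp_climb:
  assumes Cs: "Cs \<in> maxchains" and seq: "chain_seq N Cs \<gamma>"
  shows "climb m N \<gamma> (rev_perm N)"
proof -
  note ends = maxchain_endpoints[OF Cs]
  have succ: "successively covers Cs"
    using Cs by (simp add: tub_maxchains_def)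
  have len: "length Cs = length \<gamma> + 1"
    using seq by (simp add: chain_seq_def)
  have "climb m N (take k \<gamma>) (class_max N (Cs ! k))" if "k \<le> length \<gamma>" for k
    using that
  proof (induction k)
    case 0
    have "class_max N (Cs ! 0) = id"
      using ends(2) unfolding hd_conv_nth[OF ends(1)] .
    then show ?case
      unfolding take_0 by (simp only: climb_Nil)
  next
    case (Suc k)
    let ?u = "class_max N (Cs ! k)"
    have "covers (Cs ! k) (Cs ! Suc k)"
      using succ len Suc.prems by (simp add: successively_conv_nth)
    then obtain a b where jump: "jump m N ?u a b" and c: "class_max N (Cs ! Suc k) = ?u \<circ> adj_cycle a b"
        and Cs_k: "Cs ! k \<in> classes"
      using tub_cover_iff_jump by auto
    have "Suc k \<in> {1..length \<gamma>}"
      using Suc.prems by simp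
    then have "?u \<circ> \<gamma> ! (Suc k - 1) = class_max N (Cs ! Suc k)"
      using seq unfolding chain_seq_def by (metis diff_Suc_1)
    then have "?u \<circ> \<gamma> ! k = ?u \<circ> adj_cycle a b"
      using c by simp
    moreover have "inj ?u"
      using class_max(2)[OF m N Cs_k] by (rule permutes_inj)
    ultimately have "\<gamma> ! k = adj_cycle a b"
      by (metis fun.inj_map_strong inj_def comp_def ext)
    then have "take (Suc k) \<gamma> = take k \<gamma> @ [adj_cycle a b]"
      using Suc.prems by (simp add: take_Suc_conv_app_nth)
    moreover have "climb m N (take k \<gamma> @ [adj_cycle a b]) (?u \<circ> adj_cycle a b)"
      using climb_snoc[OF Suc.IH jump] Suc.prems by linarith
    ultimately show ?case
      unfolding c by (simp only:)
  qed
  from this[of "length \<gamma>"] show ?thesis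
    using ends len by (simp add: last_conv_nth)
qed

lemma climb_imp_cover_chain:
  assumes "climb m N \<gamma> u"
  shows "\<exists>Cs. successively covers Cs \<and> set Cs \<subseteq> classes \<and> Cs \<noteq> [] \<and>
    class_max N (hd Cs) = id \<and> class_max N (last Cs) = u \<and> chain_seq N Cs \<gamma>"
  using assms
proof induction
  case climb_Nil
  obtain B where "B \<in> classes" "class_max N B = id"
    using ex_class_with_max[OF m N permutes_id avoids_132_id] .
  then show ?case
    by (intro exI[of _ "[B]"]) (simp add: chain_seq_def)
next
  case (climb_snoc \<gamma> u a b)
  then obtain Cs where Cs: "successively covers Cs" "set Cs \<subseteq> classes" "Cs \<noteq> []"
      "class_max N (hd Cs) = id" "class_max N (last Cs) = u" "chain_seq N Cs \<gamma>"
    by blast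
  have u: "u permutes {1..N}" "avoids_132 m N u"
    using climb_imp_avoids_132[OF climb_snoc.hyps(1)] by auto
  obtain D where D: "D \<in> classes" "class_max N D = u \<circ> adj_cycle a b"
    using ex_class_with_max[OF m N jump_permutes[OF u(1) climb_snoc.hyps(2)]
      jump_avoids_132[OF u climb_snoc.hyps(2)]] .
  have "covers (last Cs) D"
    unfolding tub_cover_iff_jump using Cs D climb_snoc.hyps(2) by auto
  then have succ: "successively covers (Cs @ [D])"
    using Cs by (simp add: successively_append_iff)
  have len: "length Cs = length \<gamma> + 1"
    using Cs(6) by (simp add: chain_seq_def)
  have "is_adj_cycle (adj_cycle a b)"
    using climb_snoc.hyps(2) by (auto simp: is_adj_cycle_def jump_def)
  then have "chain_seq N (Cs @ [D]) (\<gamma> @ [adj_cycle a b])"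
    using Cs(3,5,6) D(2) len by (auto simp: chain_seq_def nth_append last_conv_nth le_Suc_eq)
  then show ?case
    using succ Cs D by (intro exI[of _ "Cs @ [D]"]) auto
qed

lemma climb_imp_maxchain:
  assumes "climb m N \<gamma> (rev_perm N)"
  obtains Cs where "Cs \<in> maxchains" "chain_seq N Cs \<gamma>"
  using climb_imp_cover_chain[OF assms] maxchainI by blast

lemma ex_chain_seq:
  assumes "Cs \<in> maxchains"
  obtains \<gamma> where "chain_seq N Cs \<gamma>"
proof -
  have succ: "successively covers Cs"
    using assms by (simp add: tub_maxchains_def)
  have "\<exists>c. is_adj_cycle c \<and> class_max N (Cs ! k) \<circ> c = class_max N (Cs ! Suc k)"
    if "Suc k < length Cs" for k
  proof -
    have "covers (Cs ! k) (Cs ! Suc k)"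
      using succ that by (simp add: successively_conv_nth)
    then obtain a b where "jump m N (class_max N (Cs ! k)) a b"
        "class_max N (Cs ! Suc k) = class_max N (Cs ! k) \<circ> adj_cycle a b"
      unfolding tub_cover_iff_jump by blast
    moreover from this have "is_adj_cycle (adj_cycle a b)"
      by (auto simp: is_adj_cycle_def jump_def)
    ultimately show ?thesis
      by metis
  qed
  then obtain c where c: "\<And>k. Suc k < length Cs \<Longrightarrow>
      is_adj_cycle (c k) \<and> class_max N (Cs ! k) \<circ> c k = class_max N (Cs ! Suc k)"
    by metis
  have "chain_seq N Cs (map c [0..<length Cs - 1])"
    unfolding chain_seq_def
  proof (intro conjI ballI)
    show "length Cs = length (map c [0..<length Cs - 1]) + 1"
      using maxchain_endpoints(1)[OF assms] by (cases Cs) auto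
    fix k assume "k \<in> {1..length (map c [0..<length Cs - 1])}"
    then obtain k' where k: "k = Suc k'" "Suc k' < length Cs"
      by (cases k) auto
    then have "map c [0..<length Cs - 1] ! (k - 1) = c k'"
      by simp
    then show "is_adj_cycle (map c [0..<length Cs - 1] ! (k - 1))"
      and "class_max N (Cs ! (k - 1)) \<circ> map c [0..<length Cs - 1] ! (k - 1) = class_max N (Cs ! k)"
      using c[OF k(2)] k(1) by simp_all
  qed
  then show thesis
    by (rule that)
qed

text \<open>The classes can be forgotten: chains and climbs correspond to each other with the same sequence of
cycles.\<close>

lemma SMR_eq_shortest_climbs:
  "SMR m n = {\<gamma>. climb m N \<gamma> (rev_perm N) \<and>
    (\<forall>\<gamma>'. climb m N \<gamma>' (rev_perm N) \<longrightarrow> length \<gamma> \<le> length \<gamma>')}"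
proof -
  have len: "length Cs = length \<gamma> + 1" if "chain_seq N Cs \<gamma>" for Cs \<gamma>
    using that by (simp add: chain_seq_def)
  have "\<gamma> \<in> SMR m n \<longleftrightarrow> climb m N \<gamma> (rev_perm N) \<and>
      (\<forall>\<gamma>'. climb m N \<gamma>' (rev_perm N) \<longrightarrow> length \<gamma> \<le> length \<gamma>')" for \<gamma>
  proof
    assume "\<gamma> \<in> SMR m n"
    then obtain Cs where Cs: "Cs \<in> maxchains" "chain_seq N Cs \<gamma>"
        and shortest: "\<And>Ds. Ds \<in> maxchains \<Longrightarrow> length Cs \<le> length Ds"
      unfolding SMR_def N by blast
    have "length \<gamma> \<le> length \<gamma>'" if "climb m N \<gamma>' (rev_perm N)" for \<gamma>'
    proof -
      obtain Ds where "Ds \<in> maxchains" "chain_seq N Ds \<gamma>'"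
        using climb_imp_maxchain[OF \<open>climb m N \<gamma>' (rev_perm N)\<close>] .
      then show ?thesis
        using shortest[of Ds] len Cs(2) by force
    qed
    then show "climb m N \<gamma> (rev_perm N) \<and>
        (\<forall>\<gamma>'. climb m N \<gamma>' (rev_perm N) \<longrightarrow> length \<gamma> \<le> length \<gamma>')"
      using maxchain_imp_climb[OF Cs] by blast
  next
    assume climb: "climb m N \<gamma> (rev_perm N) \<and>
        (\<forall>\<gamma>'. climb m N \<gamma>' (rev_perm N) \<longrightarrow> length \<gamma> \<le> length \<gamma>')"
    then obtain Cs where Cs: "Cs \<in> maxchains" "chain_seq N Cs \<gamma>"
      using climb_imp_maxchain by blast
    have "length Cs \<le> length Ds" if Ds: "Ds \<in> maxchains" for Ds
    proof -
      obtain \<gamma>' where \<gamma>': "chain_seq N Ds \<gamma>'"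
        using ex_chain_seq[OF Ds] .
      then show ?thesis
        using climb maxchain_imp_climb[OF Ds \<gamma>'] len[OF \<gamma>'] len[OF Cs(2)] by simp
    qed
    with Cs show "\<gamma> \<in> SMR m n"
      unfolding SMR_def N by blast
  qed
  then show ?thesis
    by blast
qed

end

section \<open>A lower bound for the length of climbs\<close>

text \<open>The value \<open>z\<close> precedes some smaller value. Values move only when they jump to the left, hence the
name.\<close>

definition moved :: "nat \<Rightarrow> (nat \<Rightarrow> nat) \<Rightarrow> nat \<Rightarrow> bool" where
  "moved N u z \<longleftrightarrow> (\<exists>x. (x, z) \<in> invs N u)"

text \<open>The number of inversions within \<open>{1..m}\<close> plus the number of values above \<open>m\<close> that have moved. It is
designed to grow by at most one per jump and to detect a repeated jump of a value above \<open>m\<close>.\<close>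

definition weight :: "nat \<Rightarrow> nat \<Rightarrow> (nat \<Rightarrow> nat) \<Rightarrow> nat" where
  "weight m N u = card {p \<in> invs N u. snd p \<le> m} + card {z. m < z \<and> moved N u z}"

lemma moved_jump:
  assumes "u permutes {1..N}" "jump m N u a b"
  shows "moved N (u \<circ> adj_cycle a b) z \<longleftrightarrow> moved N u z \<or> z = u b"
  using jump_new_inversion(1)[OF assms] unfolding moved_def invs_jump[OF assms] by blast

lemma finite_moved: "finite {z. m < z \<and> moved N u z}"
  by (rule finite_subset[of _ "{1..N}"]) (auto simp: moved_def invs_def)

lemma weight_jump:
  assumes u: "u permutes {1..N}" and jump: "jump m N u a b"
  shows "weight m N (u \<circ> adj_cycle a b) =
    weight m N u + (if m < u b \<and> moved N u (u b) then 0 else 1)"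
proof (cases "m < u b")
  case True
  have "{p \<in> invs N (u \<circ> adj_cycle a b). snd p \<le> m} = {p \<in> invs N u. snd p \<le> m}"
    unfolding invs_jump[OF u jump] using True by auto
  moreover have "{z. m < z \<and> moved N (u \<circ> adj_cycle a b) z} = insert (u b) {z. m < z \<and> moved N u z}"
    unfolding moved_jump[OF u jump] using True by auto
  ultimately show ?thesis
    using True finite_moved[of m N u] by (simp add: weight_def card_insert_if)
next
  case False
  have a: "a = b - 1" "a < b"
    using jump False by (auto simp: jump_def split: if_splits)
  have "{(u i, u b) | i. a \<le> i \<and> i < b} = {(u (b - 1), u b)}"
  proof -
    have "a \<le> i \<and> i < b \<longleftrightarrow> i = b - 1" for i
      using a by linarith
    then show ?thesis
      by simp
  qed
  then have "{p \<in> invs N (u \<circ> adj_cycle a b). snd p \<le> m} =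
      insert (u (b - 1), u b) {p \<in> invs N u. snd p \<le> m}"
    unfolding invs_jump[OF u jump] using False by auto
  moreover have "(u (b - 1), u b) \<notin> {p \<in> invs N u. snd p \<le> m}"
    using jump_new_inversion(2)[OF u jump] by simp
  moreover have "finite {p \<in> invs N u. snd p \<le> m}"
    using finite_invs[of N u] by simp
  moreover have "{z. m < z \<and> moved N (u \<circ> adj_cycle a b) z} = {z. m < z \<and> moved N u z}"
    unfolding moved_jump[OF u jump] using False by auto
  ultimately show ?thesis
    using False by (simp add: weight_def)
qed

lemma weight_id: "weight m N id = 0"
  by (simp add: weight_def moved_def invs_id)

lemma weight_le_length_climb:
  assumes "climb m N \<gamma> u"
  shows "weight m N u \<le> length \<gamma>"
  using assms
proof induction
  case climb_Nil
  show ?case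
    unfolding weight_id by simp
next
  case (climb_snoc \<gamma> u a b)
  have u: "u permutes {1..N}"
    using climb_imp_avoids_132[OF climb_snoc.hyps(1)] by simp
  show ?case
    unfolding weight_jump[OF u climb_snoc.hyps(2)] using climb_snoc.IH by simp
qed

text \<open>A necessary condition for reaching the reverse permutation by jumps of which each increases the
weight: a value above \<open>m\<close> that has moved will not move again, so it has passed all smaller values;
and the set of moved values from \<open>m\<close> on is closed upwards.\<close>

definition all_or_nothing :: "nat \<Rightarrow> nat \<Rightarrow> (nat \<Rightarrow> nat) \<Rightarrow> bool" where
  "all_or_nothing m N u \<longleftrightarrow>
    (\<forall>z>m. moved N u z \<longrightarrow> (\<forall>x. 1 \<le> x \<and> x < z \<longrightarrow> (x, z) \<in> invs N u)) \<and>
    (\<forall>z. m \<le> z \<and> z < N \<and> moved N u z \<longrightarrow> moved N u (z + 1))"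

lemma all_or_nothing_rev_perm:
  assumes "1 \<le> m"
  shows "all_or_nothing m N (rev_perm N)"
proof -
  have "moved N (rev_perm N) z \<longleftrightarrow> 1 < z \<and> z \<le> N" for z
    unfolding moved_def invs_rev_perm by auto
  then show ?thesis
    using assms by (auto simp: all_or_nothing_def invs_rev_perm)
qed

text \<open>The condition holds at the top and is passed on downwards along jumps that increase the weight.\<close>

lemma all_or_nothing_before_jump:
  assumes "1 \<le> m" and u: "u permutes {1..N}" and jump: "jump m N u a b"
    and tight: "\<not> (m < u b \<and> moved N u (u b))"
    and after: "all_or_nothing m N (u \<circ> adj_cycle a b)"
  shows "all_or_nothing m N u"
  unfolding all_or_nothing_def
proof (intro conjI allI impI)
  note new = invs_jump[OF u jump] and moved_new = moved_jump[OF u jump]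
  fix z
  {
    fix x assume "m < z" "moved N u z" "1 \<le> x \<and> x < z"
    then have "(x, z) \<in> invs N (u \<circ> adj_cycle a b)"
      using after moved_new unfolding all_or_nothing_def by blast
    moreover have "z \<noteq> u b"
      using tight \<open>m < z\<close> \<open>moved N u z\<close> by auto
    ultimately show "(x, z) \<in> invs N u"
      unfolding new by auto
  next
    assume z: "m \<le> z \<and> z < N \<and> moved N u z"
    then have "moved N (u \<circ> adj_cycle a b) (z + 1)"
      using after moved_new unfolding all_or_nothing_def by blast
    moreover have "z + 1 \<noteq> u b"
    proof
      \<comment> \<open>Suppose \<open>z + 1\<close> is the value that jumps. It must pass all smaller values at once, among
        them \<open>z\<close>; since the entry next to it bounds the run, that entry is \<open>z\<close> itself. But \<open>z\<close> has
        already passed some smaller \<open>x\<close>, which then stands to the right of \<open>z + 1\<close> and is not passed.\<close>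
      assume zb: "z + 1 = u b"
      have all: "(x, u b) \<in> invs N (u \<circ> adj_cycle a b)" if "1 \<le> x" "x < u b" for x
      proof -
        have "m < u b" "moved N (u \<circ> adj_cycle a b) (u b)"
          using z zb moved_new by auto
        then show ?thesis
          using after that unfolding all_or_nothing_def by blast
      qed
      have not_moved: "\<not> moved N u (u b)"
        using tight z zb by auto
      have in_run: "\<exists>i. x = u i \<and> a \<le> i \<and> i < b" if "1 \<le> x" "x < u b" for x
        using all[OF that] not_moved unfolding new moved_def by auto
      obtain i where i: "z = u i" "a \<le> i" "i < b"
        using in_run[of z] zb z \<open>1 \<le> m\<close> by auto
      then have "z \<le> u (b - 1)" "u (b - 1) < z + 1"
        using jump zb by (auto simp: jump_def)
      then have "u i = u (b - 1)"
        using i by simp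
      then have "i = b - 1"
        using permutes_pos(5)[OF u, of i "b - 1"] by simp
      obtain x where x: "(x, z) \<in> invs N u"
        using z by (auto simp: moved_def)
      then have "1 \<le> x" "x < z"
        by (auto simp: invs_def)
      then obtain j where j: "x = u j" "a \<le> j" "j < b"
        using in_run[of x] zb by auto
      have "inv u z < inv u x"
        using x by (simp add: invs_def)
      then have "i < j"
        unfolding i(1) j(1) permutes_pos(1)[OF u] .
      with j \<open>i = b - 1\<close> show False
        by simp
    qed
    ultimately show "moved N u (z + 1)"
      unfolding moved_new by simp
  }
qed

section \<open>Climbs of minimal length\<close>

text \<open>The word \<open>N, \<dots>, N - l + 1, r(1), \<dots>, r(m), m + 1, \<dots>, N - l\<close>; since \<open>r\<close> fixes the values above \<open>m\<close>,
the last two blocks are given by the same expression.\<close>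

definition chain_state :: "nat \<Rightarrow> nat \<Rightarrow> (nat \<Rightarrow> nat) \<Rightarrow> nat \<Rightarrow> nat" where
  "chain_state N l r i = (if 1 \<le> i \<and> i \<le> l then N + 1 - i else if l < i \<and> i \<le> N then r (i - l) else i)"

text \<open>The common walks on states \<open>(l, r)\<close>, labelled by the letters of a word. A small letter acts on \<open>r\<close>, a
big letter raises \<open>l\<close>. The side condition on small letters keeps \<open>m\<close> in the last position of \<open>r\<close>
until all big letters have been used, which is needed for the last of them to be a full
jump on the side of chains, and for no wrong inversion with \<open>m\<close> to arise on the side of words.\<close>

inductive path :: "nat \<Rightarrow> nat \<Rightarrow> nat list \<Rightarrow> nat \<Rightarrow> (nat \<Rightarrow> nat) \<Rightarrow> bool" for m n where
  path_Nil: "path m n [] 0 id"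
| path_small: "path m n \<sigma> l r \<Longrightarrow> s \<in> {1..<m} \<Longrightarrow> r s < r (s + 1) \<Longrightarrow> (l < n \<Longrightarrow> s + 1 < m) \<Longrightarrow>
    path m n (\<sigma> @ [s]) l (r \<circ> adj_transp s)"
| path_big: "path m n \<sigma> l r \<Longrightarrow> l < n \<Longrightarrow> path m n (\<sigma> @ [m + n - 1 - l]) (l + 1) r"

lemma path_invariant:
  assumes "path m n \<sigma> l r"
  shows "l \<le> n \<and> r permutes {1..m} \<and> (l < n \<longrightarrow> r m = m)"
  using assms
proof induction
  case path_Nil
  show ?case
    using permutes_id[of "{1..m}"] id_apply[of m] by blast
next
  case (path_small \<sigma> l r s)
  have "r \<circ> adj_transp s permutes {1..m}"
    by (rule permutes_compose[OF adj_transp_permutes]) (use path_small in auto)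
  moreover have "l < n \<longrightarrow> (r \<circ> adj_transp s) m = m"
    using path_small by (auto simp: adj_transp_def)
  ultimately show ?case
    using path_small by blast
next
  case (path_big \<sigma> l r)
  then show ?case
    by auto
qed

lemma big_positions_snoc:
  "big_positions m n (\<sigma> @ [s]) =
    big_positions m n \<sigma> \<union> (if s \<in> {m..<m + n} then {length \<sigma> + 1} else {})"
  by (auto simp: big_positions_def nth_append split: if_splits)

lemma big_positions_subset: "big_positions m n \<sigma> \<subseteq> {1..length \<sigma>}"
  by (auto simp: big_positions_def)

lemma card_big_positions_snoc:
  "card (big_positions m n (\<sigma> @ [s])) =
    card (big_positions m n \<sigma>) + (if s \<in> {m..<m + n} then 1 else 0)"
proof -
  have "length \<sigma> + 1 \<notin> big_positions m n \<sigma>" "finite (big_positions m n \<sigma>)"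
    using big_positions_subset[of m n \<sigma>] by (auto intro: finite_subset)
  then show ?thesis
    unfolding big_positions_snoc by simp
qed

lemma psi_Nil: "psi m n [] = []"
  by (simp add: psi_def)

lemma length_psi: "length (psi m n \<sigma>) = length \<sigma>"
  by (simp add: psi_def del: upt_Suc)

text \<open>The image of a letter depends only on the letters before it, so \<open>psi\<close> can be computed along
a walk.\<close>

lemma psi_snoc:
  "psi m n (\<sigma> @ [s]) = psi m n \<sigma> @
    [if s \<in> {m..<m + n} then adj_cycle (m + n - s) (m + n)
     else adj_cycle (s + card (big_positions m n \<sigma>)) (s + card (big_positions m n \<sigma>) + 1)]"
proof -
  let ?c = "\<lambda>\<sigma> i. let s = \<sigma> ! (i - 1); l = card {j \<in> big_positions m n \<sigma>. j < i}
    in if i \<in> big_positions m n \<sigma> then adj_cycle (m + n - s) (m + n) else adj_cycle (s + l) (s + l + 1)"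
  let ?k = "length \<sigma>"
  have old: "?c (\<sigma> @ [s]) i = ?c \<sigma> i" if i: "i \<in> {1..?k}" for i
  proof -
    have "(\<sigma> @ [s]) ! (i - 1) = \<sigma> ! (i - 1)"
      using i by (intro nth_append_left) auto
    moreover have "{j \<in> big_positions m n (\<sigma> @ [s]). j < i} = {j \<in> big_positions m n \<sigma>. j < i}"
      and "i \<in> big_positions m n (\<sigma> @ [s]) \<longleftrightarrow> i \<in> big_positions m n \<sigma>"
      using i unfolding big_positions_snoc by (auto split: if_splits)
    ultimately show ?thesis
      by simp
  qed
  have "{j \<in> big_positions m n (\<sigma> @ [s]). j < ?k + 1} = big_positions m n \<sigma>"
    using big_positions_subset[of m n \<sigma>] unfolding big_positions_snoc by (auto split: if_splits)
  moreover have "?k + 1 \<in> big_positions m n (\<sigma> @ [s]) \<longleftrightarrow> s \<in> {m..<m + n}"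
    using big_positions_subset[of m n \<sigma>] unfolding big_positions_snoc by (auto split: if_splits)
  ultimately have new: "?c (\<sigma> @ [s]) (?k + 1) = (if s \<in> {m..<m + n} then adj_cycle (m + n - s) (m + n)
     else adj_cycle (s + card (big_positions m n \<sigma>)) (s + card (big_positions m n \<sigma>) + 1))"
    by (simp add: Let_def)
  have "psi m n (\<sigma> @ [s]) = map (?c (\<sigma> @ [s])) [1..<Suc ?k] @ [?c (\<sigma> @ [s]) (?k + 1)]"
    unfolding psi_def by simp
  also have "map (?c (\<sigma> @ [s])) [1..<Suc ?k] = psi m n \<sigma>"
    unfolding psi_def by (rule map_cong[OF refl old]) (simp del: upt_Suc)
  finally show ?thesis
    unfolding new .
qed

lemma card_big_positions_path:
  assumes "path m n \<sigma> l r"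
  shows "card (big_positions m n \<sigma>) = l"
  using assms
proof induction
  case path_Nil
  then show ?case
    by (simp add: big_positions_def)
qed (auto simp: card_big_positions_snoc)

lemma psi_path_small:
  assumes "path m n \<sigma> l r" "s \<in> {1..<m}"
  shows "psi m n (\<sigma> @ [s]) = psi m n \<sigma> @ [adj_cycle (s + l) (s + l + 1)]"
  using assms(2) unfolding psi_snoc card_big_positions_path[OF assms(1)] by simp

lemma psi_path_big:
  assumes "path m n \<sigma> l r" "l < n"
  shows "psi m n (\<sigma> @ [m + n - 1 - l]) = psi m n \<sigma> @ [adj_cycle (l + 1) (m + n)]"
proof -
  have "m + n - 1 - l \<in> {m..<m + n}" "m + n - (m + n - 1 - l) = l + 1"
    using assms(2) by auto
  then show ?thesis
    unfolding psi_snoc by simp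
qed

lemma chain_state_0:
  assumes "r permutes {1..m}" "m \<le> N"
  shows "chain_state N 0 r = r"
proof
  fix i
  have "r i = i" if "i = 0 \<or> N < i"
    by (rule permutes_not_in[OF assms(1)]) (use that assms(2) in auto)
  then show "chain_state N 0 r i = r i"
    by (auto simp: chain_state_def)
qed

lemma chain_state_small_step:
  assumes "s \<in> {1..<m}" "N = m + n" "l \<le> n"
  shows "chain_state N l r \<circ> adj_cycle (s + l) (s + l + 1) = chain_state N l (r \<circ> adj_transp s)"
proof
  fix i
  show "(chain_state N l r \<circ> adj_cycle (s + l) (s + l + 1)) i = chain_state N l (r \<circ> adj_transp s) i"
  proof (cases "i = s + l \<or> i = s + l + 1")
    case True
    then show ?thesis
      using assms by (auto simp: chain_state_def adj_cycle_def adj_transp_def)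
  next
    case False
    then have "adj_cycle (s + l) (s + l + 1) i = i"
      by (auto simp: adj_cycle_def)
    moreover have "l < i \<Longrightarrow> adj_transp s (i - l) = i - l"
      unfolding adj_transp_def using False by (intro transpose_apply_other) auto
    ultimately show ?thesis
      by (auto simp: chain_state_def)
  qed
qed

lemma chain_state_big_step:
  assumes r: "r permutes {1..m}" and "N = m + n" "l < n"
  shows "chain_state N l r \<circ> adj_cycle (l + 1) N = chain_state N (l + 1) r"
proof
  fix i
  have "r (N - l) = N - l"
    by (rule permutes_not_in[OF r]) (use assms in auto)
  then show "(chain_state N l r \<circ> adj_cycle (l + 1) N) i = chain_state N (l + 1) r i"
    using assms by (auto simp: chain_state_def adj_cycle_def)
qed

lemma jump_small:
  assumes r: "r permutes {1..m}" and s: "s \<in> {1..<m}" "r s < r (s + 1)" and N: "N = m + n" "l \<le> n"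
  shows "jump m N (chain_state N l r) (s + l) (s + l + 1)"
proof -
  have "r (s + 1) \<in> {1..m}"
    using s by (simp only: permutes_pos(6)[OF r]) auto
  moreover have "chain_state N l r (s + l) = r s" "chain_state N l r (s + l + 1) = r (s + 1)"
    using s N by (auto simp: chain_state_def)
  moreover have "chain_state N l r i \<le> chain_state N l r (s + l)" if "s + l \<le> i \<and> i < s + l + 1" for i
  proof -
    have "i = s + l"
      using that by linarith
    then show ?thesis
      by simp
  qed
  ultimately show ?thesis
    unfolding jump_def using s N by auto
qed

lemma chain_state_le:
  assumes r: "r permutes {1..m}" and "m \<le> k" "l < i" "i \<le> l + k" "i \<le> N"
  shows "chain_state N l r i \<le> k"
proof (cases "i - l \<le> m")
  case True
  then have "r (i - l) \<in> {1..m}"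
    using assms by (simp only: permutes_pos(6)[OF r]) auto
  then show ?thesis
    using assms by (auto simp: chain_state_def)
next
  case False
  then have "r (i - l) = i - l"
    by (intro permutes_not_in[OF r]) auto
  then show ?thesis
    using assms by (auto simp: chain_state_def)
qed

lemma chain_state_tail:
  assumes r: "r permutes {1..m}" and "l < n \<longrightarrow> r m = m" and "m + l \<le> i" "i \<le> N" "N = m + n" "1 \<le> m"
    and "m + l < i \<or> l < n"
  shows "chain_state N l r i = i - l"
proof (cases "i = m + l")
  case True
  then show ?thesis
    using assms by (auto simp: chain_state_def)
next
  case False
  then have "r (i - l) = i - l"
    by (intro permutes_not_in[OF r]) (use assms in auto)
  then show ?thesis
    using assms by (auto simp: chain_state_def)
qed

text \<open>The value \<open>N - l\<close> is the last entry, and its left neighbour \<open>N - 1 - l\<close> is at least \<open>m\<close> and larger than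
all other entries back to the block of moved values; so the jump goes all the way. For \<open>l = n - 1\<close>
the neighbour is \<open>m\<close>, which is where \<open>r m = m\<close> enters.\<close>

lemma jump_big:
  assumes r: "r permutes {1..m}" "r m = m" and N: "N = m + n" and "l < n" "1 \<le> m"
  shows "jump m N (chain_state N l r) (l + 1) N"
proof -
  have vals: "chain_state N l r N = N - l" "chain_state N l r (N - 1) = N - 1 - l"
    using chain_state_tail[OF r(1), of l n N N] chain_state_tail[OF r(1), of l n "N - 1" N] assms by auto
  have "chain_state N l r i \<le> N - 1 - l" if "l + 1 \<le> i \<and> i < N" for i
    by (rule chain_state_le[OF r(1)]) (use that assms in auto)
  moreover have "l = 0 \<or> N - 1 - l < chain_state N l r l"
    using assms by (auto simp: chain_state_def)
  ultimately show ?thesis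
    unfolding jump_def vals using assms by auto
qed

lemma chain_state_not_moved:
  assumes r: "r permutes {1..m}" and u: "chain_state N l r permutes {1..N}" and z: "m < z" "z \<le> N - l"
  shows "\<not> moved N (chain_state N l r) z"
proof
  let ?u = "chain_state N l r"
  assume "moved N ?u z"
  then obtain x where "(x, z) \<in> invs N ?u"
    by (auto simp: moved_def)
  then have x: "1 \<le> x" "x < z" "inv ?u z < inv ?u x" "z \<le> N"
    by (auto simp: invs_def)
  have tail: "?u i = i - l" if "m + l < i" "i \<le> N" for i
  proof -
    have "r (i - l) = i - l"
      by (rule permutes_not_in[OF r]) (use that in auto)
    then show ?thesis
      using that by (auto simp: chain_state_def)
  qed
  have "?u (z + l) = z"
    using tail[of "z + l"] z by auto
  then have pos_z: "inv ?u z = z + l"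
    using permutes_pos(1)[OF u, of "z + l"] by simp
  have "inv ?u x \<in> {1..N}"
    using x by (simp only: permutes_pos(7)[OF u]) auto
  then have "?u (inv ?u x) = inv ?u x - l"
    using tail[of "inv ?u x"] x(3) pos_z z by auto
  then have "x = inv ?u x - l"
    unfolding permutes_pos(2)[OF u] .
  then show False
    using x pos_z by auto
qed

context
  fixes m n N :: nat
  assumes m: "1 \<le> m" and N: "N = m + n"
begin

text \<open>Every step along a walk is a jump that increases the weight.\<close>

lemma path_climb:
  assumes "path m n \<sigma> l r"
  shows "climb m N (psi m n \<sigma>) (chain_state N l r) \<and> weight m N (chain_state N l r) = length \<sigma>"
  using assms
proof induction
  case path_Nil
  have "chain_state N 0 id = id"
    by (rule chain_state_0[OF permutes_id[of "{1..m}"]]) (simp add: N)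
  then show ?case
    by (simp only: psi_Nil climb_Nil weight_id list.size)
next
  case (path_small \<sigma> l r s)
  note inv = path_invariant[OF path_small.hyps(1)]
  have u: "chain_state N l r permutes {1..N}"
    using climb_imp_avoids_132 path_small.IH by blast
  have jump: "jump m N (chain_state N l r) (s + l) (s + l + 1)"
    using jump_small[of r m s N n l] inv path_small.hyps N by blast
  have step: "chain_state N l r \<circ> adj_cycle (s + l) (s + l + 1) = chain_state N l (r \<circ> adj_transp s)"
    using chain_state_small_step[OF path_small.hyps(2) N] inv by blast
  have "chain_state N l r (s + l + 1) \<le> m"
    by (rule chain_state_le) (use inv path_small.hyps N in auto)
  then have "weight m N (chain_state N l (r \<circ> adj_transp s)) = length (\<sigma> @ [s])"
    using weight_jump[OF u jump] path_small.IH unfolding step by simp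
  moreover have "climb m N (psi m n (\<sigma> @ [s])) (chain_state N l (r \<circ> adj_transp s))"
    using climb_snoc[OF _ jump, of "psi m n \<sigma>"] path_small.IH
    unfolding step psi_path_small[OF path_small.hyps(1,2)] by blast
  ultimately show ?case
    by blast
next
  case (path_big \<sigma> l r)
  note inv = path_invariant[OF path_big.hyps(1)]
  have u: "chain_state N l r permutes {1..N}"
    using climb_imp_avoids_132 path_big.IH by blast
  have jump: "jump m N (chain_state N l r) (l + 1) N"
    using jump_big[of r m N n l] inv path_big.hyps N m by blast
  have step: "chain_state N l r \<circ> adj_cycle (l + 1) N = chain_state N (l + 1) r"
    using chain_state_big_step[of r m N n l] inv path_big.hyps N by blast
  have "chain_state N l r N = N - l"
    using chain_state_tail[of r m l n N N] inv path_big.hyps N m by simp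
  moreover have "\<not> moved N (chain_state N l r) (N - l)"
    using chain_state_not_moved[of r m N l "N - l"] u inv path_big.hyps N by simp
  ultimately have "weight m N (chain_state N (l + 1) r) = length \<sigma> + 1"
    using weight_jump[OF u jump] path_big.IH unfolding step by simp
  moreover have "climb m N (psi m n (\<sigma> @ [m + n - 1 - l])) (chain_state N (l + 1) r)"
    using climb_snoc[OF _ jump, of "psi m n \<sigma>"] path_big.IH
    unfolding step psi_path_big[OF path_big.hyps] unfolding N by blast
  ultimately show ?case
    by simp
qed

text \<open>Among the jumps that start at a permutation of this form, those that preserve the condition
\<open>all_or_nothing\<close> are the two kinds of steps of a walk.\<close>

lemma jump_from_chain_state:
  assumes path: "path m n \<sigma> l r" and jump: "jump m N (chain_state N l r) a b"
    and after: "all_or_nothing m N (chain_state N l r \<circ> adj_cycle a b)"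
  shows "\<exists>\<sigma>' l' r'. path m n \<sigma>' l' r' \<and> chain_state N l r \<circ> adj_cycle a b = chain_state N l' r' \<and>
    psi m n \<sigma>' = psi m n \<sigma> @ [adj_cycle a b]"
proof -
  let ?u = "chain_state N l r"
  let ?v = "?u \<circ> adj_cycle a b"
  note inv = path_invariant[OF path]
  then have r: "r permutes {1..m}" and l: "l \<le> n" and fix_m: "l < n \<longrightarrow> r m = m"
    by auto
  have u: "?u permutes {1..N}"
    using climb_imp_avoids_132 path_climb[OF path] by blast
  have ab: "1 \<le> a" "a < b" "b \<le> N" "?u (b - 1) < ?u b"
    and run: "\<And>i. a \<le> i \<Longrightarrow> i < b \<Longrightarrow> ?u i \<le> ?u (b - 1)"
    and stop: "if ?u (b - 1) < m then a = b - 1 else a = 1 \<or> ?u (b - 1) < ?u (a - 1)"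
    using jump by (auto simp: jump_def)
  have next_moved: "moved N ?u (?u b + 1)" if "m \<le> ?u b" "?u b < N"
  proof -
    have "moved N ?v (?u b)"
      unfolding moved_jump[OF u jump] by simp
    then have "moved N ?v (?u b + 1)"
      using after that unfolding all_or_nothing_def by blast
    then show ?thesis
      unfolding moved_jump[OF u jump] by simp
  qed
  consider "b \<le> l" | "b = l + 1" | "l + 1 < b" "b \<le> l + m" | "l + m < b"
    by linarith
  then show ?thesis
  proof cases
    \<comment> \<open>In the first two cases the entries at positions \<open>b - 1\<close> and \<open>b\<close> form a descent.\<close>
    case 1
    then have "?u (b - 1) = N + 1 - (b - 1)" "?u b = N + 1 - b"
      using ab by (auto simp: chain_state_def)
    then show ?thesis
      using ab by linarith
  next
    case 2
    then have "?u (b - 1) = N + 1 - l"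
      using ab by (auto simp: chain_state_def)
    moreover have "?u b \<le> m"
      by (rule chain_state_le[OF r]) (use 2 m ab in auto)
    ultimately show ?thesis
      using ab l N by linarith
  next
    case 3
    define s where "s = b - 1 - l"
    have s: "s \<in> {1..<m}" "b = s + l + 1"
      using 3 by (auto simp: s_def)
    have vals: "?u (b - 1) = r s" "?u b = r (s + 1)"
      using s ab by (auto simp: chain_state_def)
    have "r (s + 1) \<in> {1..m}"
      using s by (simp only: permutes_pos(6)[OF r]) auto
    then have "a = b - 1"
      using stop ab(4) unfolding vals by auto
    then have a: "a = s + l"
      using s by simp
    \<comment> \<open>Moving \<open>m\<close> while \<open>m + 1\<close> has not moved would violate the upward closure after the jump.\<close>
    have "s + 1 < m" if "l < n"
    proof (rule ccontr)
      assume "\<not> s + 1 < m"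
      then have "s + 1 = m"
        using s by simp
      then have "?u b = m"
        using fix_m that vals(2) by simp
      have "m + 1 \<le> N - l"
        using N that by linarith
      have "moved N ?u (m + 1)"
        using next_moved N that \<open>?u b = m\<close> by simp
      then show False
        using chain_state_not_moved[OF r u, of "m + 1"] \<open>m + 1 \<le> N - l\<close> by simp
    qed
    then have "path m n (\<sigma> @ [s]) l (r \<circ> adj_transp s)"
      using path_small[OF path s(1)] ab(4) vals by simp
    moreover have "?v = chain_state N l (r \<circ> adj_transp s)"
      unfolding a s(2) by (rule chain_state_small_step[OF s(1) N l])
    moreover have "psi m n (\<sigma> @ [s]) = psi m n \<sigma> @ [adj_cycle a b]"
      unfolding a s(2) by (rule psi_path_small[OF path s(1)])
    ultimately show ?thesis
      by blast
  next
    case 4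
    then have "l < n"
      using ab N by simp
    have vals: "?u b = b - l" "?u (b - 1) = b - 1 - l"
      using chain_state_tail[OF r fix_m, of b N] chain_state_tail[OF r fix_m, of "b - 1" N] 4 ab \<open>l < n\<close> N m by auto
    \<comment> \<open>By upward closure the jumping value \<open>b - l\<close> is the largest one that has not moved.\<close>
    have "b = N"
    proof (rule ccontr)
      assume "b \<noteq> N"
      then have "moved N ?u (b - l + 1)"
        using next_moved 4 ab unfolding vals by simp
      moreover have "m < b - l + 1" "b - l + 1 \<le> N - l"
        using \<open>b \<noteq> N\<close> 4 ab(3) by linarith+
      ultimately show False
        using chain_state_not_moved[OF r u] by blast
    qed
    have "\<not> a < l + 1"
    proof
      assume "a < l + 1"
      then have "?u l \<le> ?u (b - 1)"
        using run 4 by simp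
      moreover have "?u l = N + 1 - l"
        using \<open>a < l + 1\<close> ab by (auto simp: chain_state_def)
      ultimately show False
        using vals \<open>b = N\<close> \<open>l < n\<close> N by simp
    qed
    moreover have "\<not> l + 1 < a"
    proof
      assume "l + 1 < a"
      moreover have "?u (a - 1) \<le> N - 1 - l"
        by (rule chain_state_le[OF r]) (use \<open>l + 1 < a\<close> ab \<open>l < n\<close> N in auto)
      ultimately show False
        using stop vals \<open>b = N\<close> 4 by (auto split: if_splits)
    qed
    ultimately have a: "a = l + 1"
      by linarith
    have "path m n (\<sigma> @ [m + n - 1 - l]) (l + 1) r"
      by (rule path_big[OF path \<open>l < n\<close>])
    moreover have "?v = chain_state N (l + 1) r"
      unfolding a \<open>b = N\<close> by (rule chain_state_big_step[OF r N \<open>l < n\<close>])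
    moreover have "psi m n (\<sigma> @ [m + n - 1 - l]) = psi m n \<sigma> @ [adj_cycle a b]"
      unfolding a \<open>b = N\<close> using psi_path_big[OF path \<open>l < n\<close>] N by simp
    ultimately show ?thesis
      by blast
  qed
qed

lemma tight_climb_is_path:
  assumes "climb m N \<gamma> u" "all_or_nothing m N u" "weight m N u = length \<gamma>"
  shows "\<exists>\<sigma> l r. path m n \<sigma> l r \<and> u = chain_state N l r \<and> psi m n \<sigma> = \<gamma>"
  using assms
proof induction
  case climb_Nil
  have "chain_state N 0 id = id"
    by (rule chain_state_0[OF permutes_id[of "{1..m}"]]) (simp add: N)
  then show ?case
    using path_Nil psi_Nil by metis
next
  case (climb_snoc \<gamma> u a b)
  have u: "u permutes {1..N}"
    using climb_imp_avoids_132[OF climb_snoc.hyps(1)] by simp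
  note jump = climb_snoc.hyps(2)
  have "weight m N u \<le> length \<gamma>"
    by (rule weight_le_length_climb[OF climb_snoc.hyps(1)])
  then have tight: "\<not> (m < u b \<and> moved N u (u b))" "weight m N u = length \<gamma>"
    using climb_snoc.prems(2) unfolding weight_jump[OF u jump] by (auto split: if_splits)
  have "all_or_nothing m N u"
    by (rule all_or_nothing_before_jump[OF m u jump tight(1) climb_snoc.prems(1)])
  then obtain \<sigma> l r where *: "path m n \<sigma> l r" "u = chain_state N l r" "psi m n \<sigma> = \<gamma>"
    using climb_snoc.IH tight(2) by blast
  show ?case
    using jump_from_chain_state[OF *(1), of a b] jump climb_snoc.prems(1) *(2,3) by metis
qed

end

section \<open>Reduced words\<close>

text \<open>Words all of whose letters create an inversion; these are the reduced words.\<close>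

inductive ascent_word :: "nat \<Rightarrow> nat list \<Rightarrow> (nat \<Rightarrow> nat) \<Rightarrow> bool" for N where
  ascent_word_Nil: "ascent_word N [] id"
| ascent_word_snoc: "ascent_word N \<sigma> v \<Longrightarrow> s \<in> {1..<N} \<Longrightarrow> v s < v (s + 1) \<Longrightarrow>
    ascent_word N (\<sigma> @ [s]) (v \<circ> adj_transp s)"

lemma word_perm_Nil: "word_perm [] = id"
  by (simp add: word_perm_def)

lemma word_perm_snoc: "word_perm (\<sigma> @ [s]) = word_perm \<sigma> \<circ> adj_transp s"
proof -
  have "foldr (\<lambda>i f. adj_transp i \<circ> f) \<sigma> g = foldr (\<lambda>i f. adj_transp i \<circ> f) \<sigma> id \<circ> g" for g
    by (induction \<sigma>) (simp_all add: comp_assoc)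
  then show ?thesis
    unfolding word_perm_def by simp
qed

lemma word_perm_permutes: "set \<sigma> \<subseteq> {1..<N} \<Longrightarrow> word_perm \<sigma> permutes {1..N}"
proof (induction \<sigma> rule: rev_induct)
  case Nil
  show ?case
    unfolding word_perm_Nil by (rule permutes_id)
next
  case (snoc s \<sigma>)
  then show ?case
    unfolding word_perm_snoc by (intro permutes_compose[OF adj_transp_permutes]) auto
qed

lemma adj_transp_involutive: "v \<circ> adj_transp i \<circ> adj_transp i = v"
  by (simp add: comp_assoc adj_transp_def)

lemma card_invs_adj_transp:
  assumes v: "v permutes {1..N}" and s: "s \<in> {1..<N}"
  shows "v s < v (s + 1) \<Longrightarrow> card (invs N (v \<circ> adj_transp s)) = card (invs N v) + 1"
    and "\<not> v s < v (s + 1) \<Longrightarrow> card (invs N (v \<circ> adj_transp s)) + 1 = card (invs N v)"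
proof -
  have up: "card (invs N (v \<circ> adj_transp s)) = card (invs N v) + 1"
    if "v permutes {1..N}" "v s < v (s + 1)" for v
    unfolding invs_comp_adj_transp[OF that(1) s that(2)]
    using ascent_not_in_invs[OF that(1) s] finite_invs[of N v] by simp
  show "v s < v (s + 1) \<Longrightarrow> card (invs N (v \<circ> adj_transp s)) = card (invs N v) + 1"
    by (rule up[OF v])
  assume "\<not> v s < v (s + 1)"
  moreover have "v s \<noteq> v (s + 1)"
    using permutes_pos(5)[OF v, of s "s + 1"] by simp
  ultimately have "(v \<circ> adj_transp s) s < (v \<circ> adj_transp s) (s + 1)"
    by (simp add: adj_transp_def)
  from up[OF permutes_compose[OF adj_transp_permutes[OF s] v] this]
  show "card (invs N (v \<circ> adj_transp s)) + 1 = card (invs N v)"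
    unfolding adj_transp_involutive by linarith
qed

lemma card_invs_word_perm_le:
  "set \<sigma> \<subseteq> {1..<N} \<Longrightarrow> card (invs N (word_perm \<sigma>)) \<le> length \<sigma>"
proof (induction \<sigma> rule: rev_induct)
  case Nil
  show ?case
    unfolding word_perm_Nil invs_id by simp
next
  case (snoc s \<sigma>)
  then have s: "s \<in> {1..<N}" and v: "word_perm \<sigma> permutes {1..N}"
    and IH: "card (invs N (word_perm \<sigma>)) \<le> length \<sigma>"
    using word_perm_permutes[of \<sigma> N] by auto
  have "card (invs N (word_perm \<sigma> \<circ> adj_transp s)) \<le> card (invs N (word_perm \<sigma>)) + 1"
    using card_invs_adj_transp[OF v s] by linarith
  with IH show ?case
    unfolding word_perm_snoc length_append list.size by linarith
qed

lemma ascent_wordD: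
  assumes "ascent_word N \<sigma> v"
  shows "set \<sigma> \<subseteq> {1..<N} \<and> word_perm \<sigma> = v \<and> v permutes {1..N} \<and> card (invs N v) = length \<sigma>"
  using assms
proof induction
  case ascent_word_Nil
  show ?case
    using permutes_id[of "{1..N}"] word_perm_Nil
    by (simp only: invs_id list.set list.size card.empty empty_subsetI simp_thms)
next
  case (ascent_word_snoc \<sigma> v s)
  then have v: "v permutes {1..N}"
    by simp
  have "v \<circ> adj_transp s permutes {1..N}"
    by (rule permutes_compose[OF adj_transp_permutes[OF ascent_word_snoc.hyps(2)] v])
  moreover have "word_perm (\<sigma> @ [s]) = v \<circ> adj_transp s"
    unfolding word_perm_snoc using ascent_word_snoc.IH by simp
  moreover have "card (invs N (v \<circ> adj_transp s)) = length (\<sigma> @ [s])"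
    unfolding card_invs_adj_transp(1)[OF v ascent_word_snoc.hyps(2,3)] using ascent_word_snoc.IH by simp
  moreover have "set (\<sigma> @ [s]) \<subseteq> {1..<N}"
    using ascent_word_snoc by simp
  ultimately show ?case
    by blast
qed

lemma ascent_word_if_length:
  "set \<sigma> \<subseteq> {1..<N} \<Longrightarrow> length \<sigma> = card (invs N (word_perm \<sigma>)) \<Longrightarrow> ascent_word N \<sigma> (word_perm \<sigma>)"
proof (induction \<sigma> rule: rev_induct)
  case Nil
  show ?case
    unfolding word_perm_Nil by (rule ascent_word_Nil)
next
  case (snoc s \<sigma>)
  then have s: "s \<in> {1..<N}" and v: "word_perm \<sigma> permutes {1..N}"
    and le: "card (invs N (word_perm \<sigma>)) \<le> length \<sigma>"
    using word_perm_permutes[of \<sigma> N] card_invs_word_perm_le[of \<sigma> N] by auto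
  have len: "length \<sigma> + 1 = card (invs N (word_perm \<sigma> \<circ> adj_transp s))"
    using snoc.prems(2) unfolding word_perm_snoc length_append list.size by linarith
  have asc: "word_perm \<sigma> s < word_perm \<sigma> (s + 1)"
    using card_invs_adj_transp(2)[OF v s] le len by linarith
  then have "length \<sigma> = card (invs N (word_perm \<sigma>))"
    using card_invs_adj_transp(1)[OF v s] len by linarith
  then have "ascent_word N \<sigma> (word_perm \<sigma>)"
    using snoc by simp
  then show ?case
    unfolding word_perm_snoc by (rule ascent_word_snoc[OF _ s asc])
qed

lemma ex_ascent_word:
  assumes "w permutes {1..N}"
  obtains \<sigma> where "ascent_word N \<sigma> w"
proof -
  have "weak_le N id w"
    by (rule invs_subset_imp_weak_le[OF permutes_id assms]) (simp add: invs_id)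
  then have "\<exists>\<sigma>. ascent_word N \<sigma> w"
    unfolding weak_le_def
  proof (induction rule: rtranclp_induct)
    case base
    show ?case
      using ascent_word_Nil by blast
  next
    case (step u v)
    then show ?case
      using ascent_word_snoc unfolding weak_cover_def by blast
  qed
  then show thesis
    using that by blast
qed

text \<open>Each letter changes the number of inversions by one, so the length of a word is at least the number
of inversions, with equality iff every letter is an ascent; equality is attained by going up in
weak order.\<close>

lemma reduced_words_eq_ascent_words:
  assumes "w permutes {1..N}"
  shows "reduced_words N w = {\<sigma>. ascent_word N \<sigma> w}"
proof -
  obtain \<sigma>0 where \<sigma>0: "ascent_word N \<sigma>0 w"
    using ex_ascent_word[OF assms] .
  have "\<sigma> \<in> reduced_words N w \<longleftrightarrow> ascent_word N \<sigma> w" for \<sigma>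
  proof
    assume "\<sigma> \<in> reduced_words N w"
    then have \<sigma>: "set \<sigma> \<subseteq> {1..<N}" "word_perm \<sigma> = w" and "length \<sigma> \<le> length \<sigma>0"
      using ascent_wordD[OF \<sigma>0] unfolding reduced_words_def by blast+
    moreover have "card (invs N w) \<le> length \<sigma>"
      using card_invs_word_perm_le[OF \<sigma>(1)] \<sigma>(2) by simp
    ultimately show "ascent_word N \<sigma> w"
      using ascent_word_if_length[OF \<sigma>(1)] ascent_wordD[OF \<sigma>0] by simp
  next
    assume "ascent_word N \<sigma> w"
    then show "\<sigma> \<in> reduced_words N w"
      using ascent_wordD[of N \<sigma> w] card_invs_word_perm_le unfolding reduced_words_def by force
  qed
  then show ?thesis
    by blast
qed

section \<open>Reduced words follow the same states\<close>

text \<open>After the reversal of \<open>{1..m}\<close>, the value \<open>m\<close> in first position is replaced by \<open>N\<close> and the values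
\<open>m, \<dots>, N - 1\<close> fill the rest.\<close>

lemma w_perm_eq:
  assumes "1 \<le> m"
  shows "w_perm m n = adj_cycle m (m + n) \<circ> rev_perm m"
proof
  fix i
  let ?xs = "[m + n] @ rev [1..<m] @ [m..<m + n]"
  have len: "length ?xs = m + n"
    using assms by simp
  consider "i = 0 \<or> m + n < i" | "i = 1" | "2 \<le> i" "i \<le> m" | "m < i" "i \<le> m + n"
    by linarith
  then show "w_perm m n i = (adj_cycle m (m + n) \<circ> rev_perm m) i"
  proof cases
    case 1
    then show ?thesis
      using len by (auto simp: w_perm_def of_one_line_def rev_perm_def adj_cycle_def)
  next
    case 2
    then show ?thesis
      using assms by (auto simp: w_perm_def of_one_line_def rev_perm_def adj_cycle_def)
  next
    case 3
    then have "?xs ! (i - 1) = rev [1..<m] ! (i - 2)"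
      by (simp add: nth_append nth_Cons' numeral_2_eq_2)
    also have "\<dots> = m + 1 - i"
      using 3 by (simp add: rev_nth)
    finally show ?thesis
      using 3 len by (auto simp: w_perm_def of_one_line_def rev_perm_def adj_cycle_def)
  next
    case 4
    then have "?xs ! (i - 1) = [m..<m + n] ! (i - 1 - m)"
      using assms by (auto simp: nth_append nth_Cons')
    also have "\<dots> = i - 1"
      using 4 by simp
    finally show ?thesis
      using 4 len by (auto simp: w_perm_def of_one_line_def rev_perm_def adj_cycle_def)
  qed
qed

text \<open>The permutation reached in state \<open>(l, r)\<close> by a word: the big letters \<open>N - 1, \<dots>, N - l\<close> multiply to the
left factor, which commutes with the small letters used before all big ones are used up, because
these fix \<open>m\<close>.\<close>

definition word_state :: "nat \<Rightarrow> nat \<Rightarrow> (nat \<Rightarrow> nat) \<Rightarrow> nat \<Rightarrow> nat" where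
  "word_state N l r = adj_cycle (N - l) N \<circ> r"

context
  fixes m n N :: nat
  assumes m: "1 \<le> m" and N: "N = m + n"
begin

lemma w_perm_permutes: "w_perm m n permutes {1..N}"
proof -
  have "rev_perm m permutes {1..N}"
    by (rule permutes_subset[OF rev_perm_permutes]) (simp add: N)
  then show ?thesis
    unfolding w_perm_eq[OF m] N[symmetric]
    by (intro permutes_compose adj_cycle_permutes) (use m N in auto)
qed

lemma word_state_small_step:
  "word_state N l r \<circ> adj_transp s = word_state N l (r \<circ> adj_transp s)"
  by (simp add: word_state_def comp_assoc)

lemma word_state_tail:
  assumes "r permutes {1..m}" "l < n \<longrightarrow> r m = m" "m \<le> i" "m < i \<or> l < n"
  shows "word_state N l r i = adj_cycle (N - l) N i"
proof -
  have "r i = i"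
  proof (cases "i = m")
    case False
    then show ?thesis
      by (intro permutes_not_in[OF assms(1)]) (use assms in auto)
  qed (use assms in auto)
  then show ?thesis
    by (simp add: word_state_def)
qed

lemma word_state_big_step:
  assumes r: "r permutes {1..m}" "r m = m" and l: "l < n"
  shows "word_state N l r \<circ> adj_transp (N - 1 - l) = word_state N (l + 1) r"
proof
  fix i
  show "(word_state N l r \<circ> adj_transp (N - 1 - l)) i = word_state N (l + 1) r i"
  proof (cases "i < m")
    case True
    then have i: "adj_transp (N - 1 - l) i = i"
      unfolding adj_transp_def by (intro transpose_apply_other) (use l N in auto)
    have "r i \<noteq> m"
      using True permutes_pos(5)[OF r(1), of i m] r(2) by simp
    moreover have "r i \<le> m"
    proof (cases "i \<in> {1..m}")
      case True
      then have "r i \<in> {1..m}"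
        by (simp only: permutes_pos(6)[OF r(1)])
      then show ?thesis
        by simp
    qed (use permutes_not_in[OF r(1)] True in auto)
    ultimately have "r i < N - l" "r i < N - (l + 1)"
      using l N by linarith+
    then have "adj_cycle (N - l) N (r i) = r i" "adj_cycle (N - (l + 1)) N (r i) = r i"
      unfolding adj_cycle_def by auto
    then show ?thesis
      using i by (simp add: word_state_def)
  next
    case False
    have tail: "word_state N k r j = adj_cycle (N - k) N j" if "m \<le> j" for k j
    proof -
      have "r j = j"
      proof (cases "j = m")
        case False
        then show ?thesis
          by (intro permutes_not_in[OF r(1)]) (use that in auto)
      qed (use r in auto)
      then show ?thesis
        by (simp add: word_state_def)
    qed
    define q where "q = N - 1 - l"
    have q: "m \<le> q" "q < N" "N - l = q + 1" "N - (l + 1) = q" "N - 1 - l = q"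
      using l N by (auto simp: q_def)
    have "m \<le> adj_transp q i" "m \<le> i"
      using False q(1) by (auto simp: adj_transp_def transpose_def)
    then show ?thesis
      unfolding q(5) comp_apply by (simp only: tail q(3,4))
        (use q(2) in \<open>auto simp: adj_transp_def transpose_def adj_cycle_def\<close>)
  qed
qed

lemma path_imp_ascent_word:
  assumes "path m n \<sigma> l r"
  shows "ascent_word N \<sigma> (word_state N l r)"
  using assms
proof induction
  case path_Nil
  have "word_state N 0 id = id"
    by (auto simp: word_state_def adj_cycle_def)
  then show ?case
    using ascent_word_Nil by metis
next
  case (path_small \<sigma> l r s)
  have inv: "l \<le> n" "r permutes {1..m}" "l < n \<longrightarrow> r m = m"
    using path_invariant[OF path_small.hyps(1)] by auto
  have rng: "r i \<in> {1..m}" if "i \<in> {1..m}" for i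
    using that by (simp only: permutes_pos(6)[OF inv(2)])
  have "r s \<le> m" "r (s + 1) \<le> m"
    using rng[of s] rng[of "s + 1"] path_small.hyps(2) by auto
  moreover have "adj_cycle (N - l) N x < adj_cycle (N - l) N y" if "x < y" "y \<le> m" for x y
    using that inv(1) N by (auto simp: adj_cycle_def)
  ultimately have "word_state N l r s < word_state N l r (s + 1)"
    using path_small.hyps(3) unfolding word_state_def by simp
  then show ?case
    unfolding word_state_small_step[symmetric]
    by (intro ascent_word_snoc[OF path_small.IH]) (use path_small.hyps(2) N in auto)
next
  case (path_big \<sigma> l r)
  have inv: "l \<le> n" "r permutes {1..m}" "r m = m"
    using path_invariant[OF path_big.hyps(1)] path_big.hyps(2) by auto
  have "word_state N l r (N - 1 - l) = N - 1 - l" "word_state N l r (N - 1 - l + 1) = N"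
    using word_state_tail[OF inv(2), of l] inv path_big.hyps(2) N by (auto simp: adj_cycle_def)
  moreover have "N - 1 - l \<in> {1..<N}" "N - 1 - l < N"
    using path_big.hyps(2) N m by auto
  ultimately show ?case
    unfolding word_state_big_step[OF inv(2,3) path_big.hyps(2), symmetric] N[symmetric]
    by (intro ascent_word_snoc[OF path_big.IH]) simp_all
qed

lemma invs_w_perm:
  assumes "(x, z) \<in> invs N (w_perm m n)"
  shows "z = N \<or> z < m"
proof (rule ccontr)
  assume "\<not> (z = N \<or> z < m)"
  moreover have xz: "1 \<le> x" "x < z" "z \<le> N" "inv (w_perm m n) z < inv (w_perm m n) x"
    using assms by (auto simp: invs_def)
  ultimately have z: "m \<le> z" "z < N"
    by auto
  then have "w_perm m n (z + 1) = z"
    using m N unfolding w_perm_eq[OF m] by (auto simp: rev_perm_def adj_cycle_def)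
  then have pos_z: "inv (w_perm m n) z = z + 1"
    using permutes_pos(1)[OF w_perm_permutes, of "z + 1"] by simp
  define i where "i = inv (w_perm m n) x"
  have "i \<in> {1..N}"
    unfolding i_def permutes_pos(7)[OF w_perm_permutes] using xz by simp
  moreover have "z + 1 < i"
    using xz pos_z by (simp add: i_def)
  ultimately have "w_perm m n i = i - 1"
    using z N unfolding w_perm_eq[OF m] by (auto simp: rev_perm_def adj_cycle_def)
  moreover have "w_perm m n i = x"
    unfolding i_def by (rule permutes_pos(2)[OF w_perm_permutes])
  ultimately show False
    using xz \<open>z + 1 < i\<close> by simp
qed

text \<open>A prefix of a reduced word of \<open>w_perm m n\<close> only has inversions of \<open>w_perm m n\<close>, and by
\<open>invs_w_perm\<close> the larger value of such an inversion is \<open>N\<close> or below \<open>m\<close>. This leaves only the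
steps of a walk.\<close>

lemma ascent_word_imp_path:
  assumes "ascent_word N \<sigma> v" "invs N v \<subseteq> invs N (w_perm m n)"
  shows "\<exists>l r. path m n \<sigma> l r \<and> v = word_state N l r"
  using assms
proof induction
  case ascent_word_Nil
  have "word_state N 0 id = id"
    by (auto simp: word_state_def adj_cycle_def)
  then show ?case
    using path_Nil by metis
next
  case (ascent_word_snoc \<sigma> v s)
  have v: "v permutes {1..N}"
    using ascent_wordD[OF ascent_word_snoc.hyps(1)] by simp
  note s = ascent_word_snoc.hyps(2) and asc = ascent_word_snoc.hyps(3)
  have new: "invs N (v \<circ> adj_transp s) = insert (v s, v (s + 1)) (invs N v)"
    by (rule invs_comp_adj_transp[OF v s asc])
  then have "invs N v \<subseteq> invs N (w_perm m n)"
    using ascent_word_snoc.prems by blast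
  then obtain l r where path: "path m n \<sigma> l r" and v_eq: "v = word_state N l r"
    using ascent_word_snoc.IH by blast
  have inv: "l \<le> n" "r permutes {1..m}" "l < n \<longrightarrow> r m = m"
    using path_invariant[OF path] by auto
  have pair: "v (s + 1) = N \<or> v (s + 1) < m"
    by (rule invs_w_perm[of "v s"]) (use new ascent_word_snoc.prems in blast)
  have tail: "v i = adj_cycle (N - l) N i" if "m \<le> i" "m < i \<or> l < n" for i
    unfolding v_eq by (rule word_state_tail[OF inv(2,3) that])
  show ?case
  proof (cases "s < m")
    case True
    have rng: "r i \<in> {1..m}" if "i \<in> {1..m}" for i
      using that by (simp only: permutes_pos(6)[OF inv(2)])
    have small: "r s \<le> m" "r (s + 1) \<le> m"
      using rng[of s] rng[of "s + 1"] True s by auto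
    have "adj_cycle (N - l) N x < adj_cycle (N - l) N y" if "x < y" "y \<le> m" for x y
      using that inv(1) N by (auto simp: adj_cycle_def)
    then have "\<not> r (s + 1) < r s"
      using asc small unfolding v_eq word_state_def by (metis comp_apply less_asym)
    moreover have "r (s + 1) \<noteq> r s"
      using permutes_pos(5)[OF inv(2), of "s + 1" s] by simp
    ultimately have "r s < r (s + 1)"
      by linarith
    moreover have "s + 1 < m" if "l < n"
    proof (rule ccontr)
      assume "\<not> s + 1 < m"
      then have "s + 1 = m"
        using True by simp
      moreover have "m < N - l"
        using that N by linarith
      ultimately have "v (s + 1) = m"
        using tail[of m] that by (simp add: adj_cycle_def)
      then show False
        using pair that N by simp
    qed
    ultimately have "path m n (\<sigma> @ [s]) l (r \<circ> adj_transp s)"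
      using path_small[OF path] True s by simp
    then show ?thesis
      unfolding v_eq word_state_small_step by blast
  next
    case False
    have v_next: "v (s + 1) = adj_cycle (N - l) N (s + 1)"
      using tail False by simp
    \<comment> \<open>Past position \<open>m\<close> the word is increasing apart from \<open>N\<close>, and only \<open>N\<close> may move there.\<close>
    have "s + 1 = N - l"
    proof (rule ccontr)
      assume "s + 1 \<noteq> N - l"
      then have "v (s + 1) = s + 1 \<and> s + 1 < N - l \<or> v (s + 1) = s \<and> N - l < s + 1"
        using v_next s by (auto simp: adj_cycle_def)
      then show False
        using pair False s by auto
    qed
    then have "s = m + n - 1 - l" "l < n"
      using False N s by auto
    then have "path m n (\<sigma> @ [s]) (l + 1) r"
      using path_big[OF path] by simp
    moreover have "v \<circ> adj_transp s = word_state N (l + 1) r"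
      using word_state_big_step[OF inv(2) _ \<open>l < n\<close>] inv(3) \<open>l < n\<close> \<open>s = m + n - 1 - l\<close> N
      unfolding v_eq by simp
    ultimately show ?thesis
      by blast
  qed
qed

lemma w_perm_eq_word_state:
  assumes "l \<le> n" "r permutes {1..m}" "l < n \<longrightarrow> r m = m"
  shows "w_perm m n = word_state N l r \<longleftrightarrow> l = n \<and> r = rev_perm m"
proof
  assume eq: "w_perm m n = word_state N l r"
  have "l = n"
  proof (rule ccontr)
    assume "l \<noteq> n"
    then have "word_state N l r (N - l) = N"
      using word_state_tail[OF assms(2,3), of "N - l"] assms(1) N by (simp add: adj_cycle_def)
    moreover have "w_perm m n 1 = N"
      using m N unfolding w_perm_eq[OF m] by (simp add: rev_perm_def adj_cycle_def)
    ultimately have "N - l = 1"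
      using eq permutes_pos(5)[OF w_perm_permutes, of "N - l" 1] by simp
    then show False
      using \<open>l \<noteq> n\<close> assms(1) m N by simp
  qed
  moreover have "inj (adj_cycle m N)"
    by (rule permutes_inj[OF adj_cycle_permutes[of m N N]]) (use m N in auto)
  then have "r = rev_perm m"
    using eq \<open>l = n\<close> N unfolding w_perm_eq[OF m] word_state_def
    by (intro ext) (metis add_diff_cancel_right' comp_apply injD)
  ultimately show "l = n \<and> r = rev_perm m" ..
next
  assume "l = n \<and> r = rev_perm m"
  then show "w_perm m n = word_state N l r"
    unfolding w_perm_eq[OF m] word_state_def N by simp
qed

lemma reduced_words_eq_paths:
  "reduced_words N (w_perm m n) = {\<sigma>. path m n \<sigma> n (rev_perm m)}"
proof -
  have "ascent_word N \<sigma> (w_perm m n) \<longleftrightarrow> path m n \<sigma> n (rev_perm m)" for \<sigma>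
  proof
    assume "ascent_word N \<sigma> (w_perm m n)"
    then obtain l r where "path m n \<sigma> l r" "w_perm m n = word_state N l r"
      using ascent_word_imp_path by blast
    then show "path m n \<sigma> n (rev_perm m)"
      using w_perm_eq_word_state path_invariant by metis
  next
    assume path: "path m n \<sigma> n (rev_perm m)"
    have "w_perm m n = word_state N n (rev_perm m)"
      using w_perm_eq_word_state path_invariant[OF path] by blast
    then show "ascent_word N \<sigma> (w_perm m n)"
      using path_imp_ascent_word[OF path] by simp
  qed
  then show ?thesis
    unfolding reduced_words_eq_ascent_words[OF w_perm_permutes] by blast
qed

section \<open>Shortest climbs are the images of reduced words\<close>

lemma chain_state_eq_rev_perm:
  assumes "l \<le> n" "r permutes {1..m}"
  shows "chain_state N l r = rev_perm N \<longleftrightarrow> l = n \<and> r = rev_perm m"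
proof
  assume eq: "chain_state N l r = rev_perm N"
  have "l = n"
  proof (rule ccontr)
    assume "l \<noteq> n"
    then have "l < N" "m < N - l"
      using assms(1) m N by linarith+
    then have "chain_state N l r N = N - l"
      using permutes_not_in[OF assms(2), of "N - l"] by (simp add: chain_state_def)
    then show False
      using eq \<open>l \<noteq> n\<close> assms(1) m N by (simp add: rev_perm_def)
  qed
  moreover have "r i = rev_perm m i" for i
  proof (cases "i \<in> {1..m}")
    case True
    then have "chain_state N l r (n + i) = r i" "rev_perm N (n + i) = rev_perm m i"
      using \<open>l = n\<close> N by (auto simp: chain_state_def rev_perm_def)
    then show ?thesis
      using eq by simp
  next
    case False
    then show ?thesis
      using permutes_not_in[OF assms(2)] permutes_not_in[OF rev_perm_permutes] by metis
  qed
  ultimately show "l = n \<and> r = rev_perm m"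
    by blast
next
  assume "l = n \<and> r = rev_perm m"
  then show "chain_state N l r = rev_perm N"
    using N by (auto simp: chain_state_def rev_perm_def fun_eq_iff)
qed

text \<open>Walks to the final state exist because \<open>w_perm m n\<close> has a reduced word. Hence the lower bound given
by the weight is attained, and the shortest climbs are those that attain it.\<close>

lemma SMR_eq_psi_image: "SMR m n = psi m n ` {\<sigma>. path m n \<sigma> n (rev_perm m)}"
proof -
  have chain_state_end: "chain_state N n (rev_perm m) = rev_perm N"
    using chain_state_eq_rev_perm[of n "rev_perm m"] rev_perm_permutes by blast
  have lower: "weight m N (rev_perm N) \<le> length \<gamma>" if "climb m N \<gamma> (rev_perm N)" for \<gamma>
    by (rule weight_le_length_climb[OF that])
  have path_tight: "climb m N (psi m n \<sigma>) (rev_perm N) \<and> length (psi m n \<sigma>) = weight m N (rev_perm N)"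
    if "path m n \<sigma> n (rev_perm m)" for \<sigma>
    using path_climb[OF m N that] unfolding chain_state_end length_psi by simp
  obtain \<sigma>0 where "ascent_word N \<sigma>0 (w_perm m n)"
    using ex_ascent_word[OF w_perm_permutes] .
  then have \<sigma>0: "path m n \<sigma>0 n (rev_perm m)"
    using reduced_words_eq_paths reduced_words_eq_ascent_words[OF w_perm_permutes] by blast
  have "\<gamma> \<in> SMR m n \<longleftrightarrow> climb m N \<gamma> (rev_perm N) \<and> weight m N (rev_perm N) = length \<gamma>" for \<gamma>
    unfolding SMR_eq_shortest_climbs[OF m N] mem_Collect_eq
    using lower path_tight[OF \<sigma>0] by (metis le_antisym)
  moreover have "climb m N \<gamma> (rev_perm N) \<and> weight m N (rev_perm N) = length \<gamma> \<longleftrightarrow>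
      (\<exists>\<sigma>. path m n \<sigma> n (rev_perm m) \<and> \<gamma> = psi m n \<sigma>)" for \<gamma>
  proof
    assume "climb m N \<gamma> (rev_perm N) \<and> weight m N (rev_perm N) = length \<gamma>"
    then obtain \<sigma> l r where "path m n \<sigma> l r" "rev_perm N = chain_state N l r" "psi m n \<sigma> = \<gamma>"
      using tight_climb_is_path[OF m N _ all_or_nothing_rev_perm[OF m]] by blast
    then show "\<exists>\<sigma>. path m n \<sigma> n (rev_perm m) \<and> \<gamma> = psi m n \<sigma>"
      using chain_state_eq_rev_perm path_invariant by metis
  next
    assume "\<exists>\<sigma>. path m n \<sigma> n (rev_perm m) \<and> \<gamma> = psi m n \<sigma>"
    then show "climb m N \<gamma> (rev_perm N) \<and> weight m N (rev_perm N) = length \<gamma>"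
      using path_tight by metis
  qed
  ultimately show ?thesis
    by blast
qed

end

section \<open>Injectivity and descents\<close>

lemma path_snocE:
  assumes "path m n (\<sigma> @ [s]) l r"
  obtains (small) r' where "path m n \<sigma> l r'" "s \<in> {1..<m}" "r' s < r' (s + 1)" "l < n \<longrightarrow> s + 1 < m"
      "r = r' \<circ> adj_transp s"
  | (big) k where "path m n \<sigma> k r" "k < n" "l = k + 1" "s = m + n - 1 - k"
  using assms by (cases rule: path.cases) auto

text \<open>A small letter exists only for \<open>m \<ge> 2\<close>, and then the cycle of a big letter has length at least 3.\<close>

lemma adj_cycle_small_neq_big:
  assumes "s \<in> {1..<m}" "k < n"
  shows "adj_cycle (s + l) (s + l + 1) \<noteq> adj_cycle (k + 1) (m + n)"
proof
  assume eq: "adj_cycle (s + l) (s + l + 1) = adj_cycle (k + 1) (m + n)"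
  have "s + l = k + 1 \<and> s + l + 1 = m + n"
    by (rule adj_cycle_inject[OF _ _ eq]) (use assms in auto)
  then show False
    using assms by auto
qed

lemma psi_inject_on_paths:
  "path m n \<sigma> l r \<Longrightarrow> path m n \<sigma>' l' r' \<Longrightarrow> psi m n \<sigma> = psi m n \<sigma>' \<Longrightarrow> \<sigma> = \<sigma>'"
proof (induction \<sigma> arbitrary: \<sigma>' l r l' r' rule: rev_induct)
  case Nil
  then show ?case
    using length_psi[of m n \<sigma>'] by (simp add: psi_Nil)
next
  case (snoc s \<sigma>)
  have "length \<sigma>' = length (\<sigma> @ [s])"
    using snoc.prems(3) length_psi by metis
  then obtain \<tau> t where \<sigma>': "\<sigma>' = \<tau> @ [t]"
    by (cases \<sigma>' rule: rev_cases) auto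
  have psi_eq: "psi m n \<sigma> = psi m n \<tau>"
    using snoc.prems(3) unfolding \<sigma>' psi_snoc by simp
  have level: "k = k'" if "path m n \<sigma> k q" "path m n \<tau> k' q'" for k q k' q'
    using snoc.IH[OF that psi_eq] card_big_positions_path that by metis
  from snoc.prems(1) show ?case
  proof (cases rule: path_snocE)
    case s_small: (small q)
    from snoc.prems(2)[unfolded \<sigma>'] show ?thesis
    proof (cases rule: path_snocE)
      case t_small: (small q')
      have "l = l'"
        by (rule level[OF s_small(1) t_small(1)])
      have "adj_cycle (s + l) (s + l + 1) = adj_cycle (t + l') (t + l' + 1)"
        using snoc.prems(3) unfolding \<sigma>' psi_path_small[OF s_small(1,2)] psi_path_small[OF t_small(1,2)]
        by simp
      then have "s + l = t + l'"
        using adj_cycle_inject[of "s + l" "s + l + 1" "t + l'" "t + l' + 1"] by simp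
      then show ?thesis
        unfolding \<sigma>' using \<open>l = l'\<close> snoc.IH[OF s_small(1) t_small(1) psi_eq] by simp
    next
      case t_big: (big k')
      then show ?thesis
        using snoc.prems(3) adj_cycle_small_neq_big[OF s_small(2), of k' n l]
        unfolding \<sigma>' t_big(4) psi_path_small[OF s_small(1,2)] psi_path_big[OF t_big(1,2)] by simp
    qed
  next
    case s_big: (big k)
    from snoc.prems(2)[unfolded \<sigma>'] show ?thesis
    proof (cases rule: path_snocE)
      case t_small: (small q')
      then show ?thesis
        using snoc.prems(3) adj_cycle_small_neq_big[OF t_small(2) s_big(2), of l']
        unfolding \<sigma>' s_big(4) psi_path_small[OF t_small(1,2)] psi_path_big[OF s_big(1,2)] by simp
    next
      case t_big: (big k')
      then show ?thesis
        unfolding \<sigma>' using level[OF s_big(1) t_big(1)] s_big(4) snoc.IH[OF s_big(1) t_big(1) psi_eq] by simp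
    qed
  qed
qed

lemma word_Des_snoc2:
  "word_Des (\<tau> @ [t] @ [s]) = word_Des (\<tau> @ [t]) \<union> (if s < t then {length \<tau> + 1} else {})"
  by (auto simp: word_Des_def nth_append less_Suc_eq split: if_splits)

lemma cycle_Des_snoc2:
  "cycle_Des (\<gamma> @ [c] @ [d]) =
    cycle_Des (\<gamma> @ [c]) \<union> (if cycle_top d \<le> cycle_top c then {length \<gamma> + 1} else {})"
  by (auto simp: cycle_Des_def nth_append less_Suc_eq split: if_splits)

text \<open>Two small letters are compared at the same level \<open>l\<close>, and they differ as a letter cannot be repeated
in a reduced word. A big letter has the cycle with upper end \<open>m + n\<close>, and a small letter before it
has \<open>l < n\<close>, so that its cycle ends below \<open>m + n\<close>.\<close>

lemma path_descent:
  assumes "1 \<le> m" and path: "path m n ((\<tau> @ [t]) @ [s]) l r"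
  obtains c d where "psi m n (\<tau> @ [t]) = psi m n \<tau> @ [c]"
    "psi m n ((\<tau> @ [t]) @ [s]) = psi m n (\<tau> @ [t]) @ [d]"
    "s < t \<longleftrightarrow> cycle_top d \<le> cycle_top c"
  using path
proof (cases rule: path_snocE)
  case s_small: (small q)
  have l: "l \<le> n"
    using path_invariant[OF s_small(1)] by simp
  note psi_s = psi_path_small[OF s_small(1,2)]
  have top_s: "cycle_top (adj_cycle (s + l) (s + l + 1)) = s + l + 1"
    by (rule cycle_top_adj_cycle) simp
  from s_small(1) show thesis
  proof (cases rule: path_snocE)
    case t_small: (small q')
    have "s \<noteq> t"
      using s_small(3) t_small(3) unfolding t_small(5) by (auto simp: adj_transp_def)
    moreover have "cycle_top (adj_cycle (t + l) (t + l + 1)) = t + l + 1"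
      by (rule cycle_top_adj_cycle) simp
    ultimately have "s < t \<longleftrightarrow>
        cycle_top (adj_cycle (s + l) (s + l + 1)) \<le> cycle_top (adj_cycle (t + l) (t + l + 1))"
      unfolding top_s by linarith
    then show thesis
      by (rule that[OF psi_path_small[OF t_small(1,2)] psi_s])
  next
    case t_big: (big k)
    have "cycle_top (adj_cycle (k + 1) (m + n)) = m + n"
      by (rule cycle_top_adj_cycle) (use t_big(2) s_small(2) in auto)
    then show thesis
      using that[OF psi_path_big[OF t_big(1,2), folded t_big(4)] psi_s] top_s s_small(2) t_big l by auto
  qed
next
  case s_big: (big k)
  note psi_s = psi_path_big[OF s_big(1,2), folded s_big(4)]
  from s_big(1) show thesis
  proof (cases rule: path_snocE)
    case t_small: (small q')
    have "cycle_top (adj_cycle (t + k) (t + k + 1)) = t + k + 1"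
      by (rule cycle_top_adj_cycle) simp
    moreover have "cycle_top (adj_cycle (k + 1) (m + n)) = m + n"
      by (rule cycle_top_adj_cycle) (use t_small(2) s_big(2) in auto)
    ultimately show thesis
      using that[OF psi_path_small[OF t_small(1,2)] psi_s] t_small(2) s_big by auto
  next
    case t_big: (big j)
    have "cycle_top (adj_cycle (k + 1) (m + n)) = m + n"
      "cycle_top (adj_cycle (j + 1) (m + n)) = m + n"
      by (rule cycle_top_adj_cycle; use t_big(2,3) s_big(2) \<open>1 \<le> m\<close> in simp)+
    moreover have "s < t"
      using t_big(3,4) s_big(2,4) by simp
    ultimately show thesis
      using that[OF psi_path_big[OF t_big(1,2), folded t_big(4)] psi_s] by simp
  qed
qed

lemma Des_psi: "1 \<le> m \<Longrightarrow> path m n \<sigma> l r \<Longrightarrow> word_Des \<sigma> = cycle_Des (psi m n \<sigma>)"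
proof (induction \<sigma> arbitrary: l r rule: rev_induct)
  case Nil
  show ?case
    by (simp add: psi_Nil word_Des_def cycle_Des_def)
next
  case (snoc s \<sigma>)
  show ?case
  proof (cases \<sigma> rule: rev_cases)
    case Nil
    then show ?thesis
      using length_psi[of m n "[s]"] by (auto simp: word_Des_def cycle_Des_def)
  next
    case (snoc \<tau> t)
    note path = \<open>path m n (\<sigma> @ [s]) l r\<close>
    have IH: "word_Des \<sigma> = cycle_Des (psi m n \<sigma>)"
      using path by (cases rule: path_snocE) (use snoc.IH \<open>1 \<le> m\<close> in blast)+
    obtain c d where c: "psi m n (\<tau> @ [t]) = psi m n \<tau> @ [c]"
      and d: "psi m n ((\<tau> @ [t]) @ [s]) = psi m n (\<tau> @ [t]) @ [d]"
      and desc: "s < t \<longleftrightarrow> cycle_top d \<le> cycle_top c"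
      using path_descent[OF \<open>1 \<le> m\<close>] path unfolding snoc by blast
    show ?thesis
      using IH word_Des_snoc2[of \<tau> t s] cycle_Des_snoc2[of "psi m n \<tau>" c d] desc
      unfolding snoc d c by (simp add: length_psi)
  qed
qed

theorem theorem8p3:
  fixes m n :: nat
  assumes "m \<ge> 1"
  shows "bij_betw (psi m n) (reduced_words (m + n) (w_perm m n)) (SMR m n)
    \<and> (\<forall>\<sigma> \<in> reduced_words (m + n) (w_perm m n). word_Des \<sigma> = cycle_Des (psi m n \<sigma>))"
proof -
  have words: "reduced_words (m + n) (w_perm m n) = {\<sigma>. path m n \<sigma> n (rev_perm m)}"
    by (rule reduced_words_eq_paths[OF assms refl])
  have "inj_on (psi m n) {\<sigma>. path m n \<sigma> n (rev_perm m)}"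
    using psi_inject_on_paths by (auto intro!: inj_onI)
  then show ?thesis
    unfolding words SMR_eq_psi_image[OF assms refl] using Des_psi[OF assms] by (auto simp: bij_betw_def)
qed

end
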